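(* Let $(p_n)_{n=1}^\infty$ be a sequence in $[1,\infty)$ such that $\lim_n p_n=\infty$. Then: (a) Any greedy basic sequence in $h_{(p_n)}$ is equivalent to the unit vector basis of $c_0$. (b) A (closed) subspace of $h_{(p_n)}$ has a greedy basis if and only if it is isomorphic to $c_0$. (c) The space $h_{(p_n)}$ has a greedy basis if and only if $h_{(p_n)}=c_0$ (equality as sets of sequences, with equivalent norms).
   Context: Nakano spaces: for a sequence $(p_n)_{n=1}^\infty$ in $[1,\infty)$ and a real sequence $\alpha=(a_n)_{n=1}^\infty$ put $m_{(p_n)}(\alpha)=\sum_{n=1}^\infty |a_n|^{p_n}$ and $\|\alpha\|_{(p_n)}=\inf\{t>0 : m_{(p_n)}(\alpha/t)\le 1\}$; $\ell_{(p_n)}$ is the Banach space of all real sequences $\alpha$ with $m_{(p_n)}(\alpha/t)<\infty$ for some $t>0$, with norm $\|\cdot\|_{(p_n)}$, and $h_{(p_n)}$ is the closed linear span in $\ell_{(p_n)}$ of the canonical unit vectors $(e_n)_{n=1}^\infty$. Bases: all spaces are real Banach spaces. A basis is a Schauder basis $(x_n)_{n=1}^\infty$ (indexed by $\mathbb{N}$), and all bases and basic sequences are assumed semi-normalized, i.e. $0<\inf_n\|x_n\|\le\sup_n\|x_n\|<\infty$. A basis $(x_n)$ of $X$ with biorthogonal functionals $(x_n^* )$ is greedy if there is a constant $C$ such that for every $x\in X$, every $N\in\mathbb{N}$, and every set $\Lambda\subseteq\mathbb{N}$ with $|\Lambda|=N$ and $\min_{n\in\Lambda}|x_n^*(x)|\ge\max_{n\notin\Lambda}|x_n^*(x)|$,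 one has $\|x-\sum_{n\in\Lambda}x_n^*(x)x_n\|\le C\inf\{\|x-\sum_{n\in A}\alpha_n x_n\| : |A|=N,\ \alpha_n\in\mathbb{R}\}$. A greedy basic sequence is a sequence that is a greedy basis of its closed linear span. Two basic sequences $(x_n)$, $(y_n)$ are equivalent if there is $C\ge1$ with $C^{-1}\|\sum a_nx_n\|\le\|\sum a_ny_n\|\le C\|\sum a_nx_n\|$ for all finitely supported real sequences $(a_n)$. *)

theory Defs
  imports "HOL-Analysis.Analysis" "HOL-Library.Function_Algebras"
begin

instantiation "fun" :: (type, real_vector) real_vector
begin

definition "scaleR c f = (\<lambda>x. c *\<^sub>R f x)"

instance
  by standard (simp_all add: scaleR_fun_def fun_eq_iff scaleR_add_right scaleR_add_left)

end

text \<open>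
  The Nakano norm depends on the parameter \<open>p\<close> and is a norm only on a subset of all sequences.
  A normed space is therefore given by a function \<open>N\<close> together with a carrier \<open>X\<close> (a linear
  subspace of the ambient vector space on which \<open>N\<close> is a norm). The topology is always the one
  of \<open>N\<close>; the product topology of the type \<open>nat \<Rightarrow> real\<close> plays no role.
\<close>

definition norm_closure ::
    "('a::real_vector \<Rightarrow> real) \<Rightarrow> 'a set \<Rightarrow> 'a set \<Rightarrow> 'a set" where
  "norm_closure N X S = {v \<in> X. \<forall>\<epsilon>>0. \<exists>u\<in>S. N (v - u) < \<epsilon>}"

definition closed_subspace ::
    "('a::real_vector \<Rightarrow> real) \<Rightarrow> 'a set \<Rightarrow> 'a set \<Rightarrow> bool" where
  "closed_subspace N X Y \<longleftrightarrow> subspace Y \<and> Y \<subseteq> X \<and> norm_closure N X Y = Y"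

definition closed_span ::
    "('a::real_vector \<Rightarrow> real) \<Rightarrow> 'a set \<Rightarrow> 'a set \<Rightarrow> 'a set" where
  "closed_span N X S = norm_closure N X (span S)"

definition is_expansion ::
    "('a::real_vector \<Rightarrow> real) \<Rightarrow> (nat \<Rightarrow> 'a) \<Rightarrow> 'a \<Rightarrow> (nat \<Rightarrow> real) \<Rightarrow> bool" where
  "is_expansion N x v a \<longleftrightarrow> (\<lambda>m. N (v - (\<Sum>n<m. a n *\<^sub>R x n))) \<longlonglongrightarrow> 0"

definition schauder_basis ::
    "('a::real_vector \<Rightarrow> real) \<Rightarrow> 'a set \<Rightarrow> (nat \<Rightarrow> 'a) \<Rightarrow> bool" where
  "schauder_basis N X x \<longleftrightarrow> range x \<subseteq> X \<and> (\<forall>v\<in>X. \<exists>!a. is_expansion N x v a)"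

text \<open>\<open>coeff_functional N x n\<close> is the biorthogonal functional of index \<open>n\<close>; it is meaningful
  only when \<open>x\<close> is a Schauder basis of a space containing the argument.\<close>

definition coeff_functional ::
    "('a::real_vector \<Rightarrow> real) \<Rightarrow> (nat \<Rightarrow> 'a) \<Rightarrow> nat \<Rightarrow> 'a \<Rightarrow> real" where
  "coeff_functional N x n v = (THE a. is_expansion N x v a) n"

definition semi_normalized ::
    "('a \<Rightarrow> real) \<Rightarrow> (nat \<Rightarrow> 'a) \<Rightarrow> bool" where
  "semi_normalized N x \<longleftrightarrow> (\<exists>c>0. \<exists>C. \<forall>n. c \<le> N (x n) \<and> N (x n) \<le> C)"

definition best_approx_error ::
    "('a::real_vector \<Rightarrow> real) \<Rightarrow> (nat \<Rightarrow> 'a) \<Rightarrow> nat \<Rightarrow> 'a \<Rightarrow> real" where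
  "best_approx_error N x k v =
     Inf {N (v - (\<Sum>n\<in>A. \<alpha> n *\<^sub>R x n)) | A \<alpha>. finite A \<and> card A = k}"

definition greedy_basis ::
    "('a::real_vector \<Rightarrow> real) \<Rightarrow> 'a set \<Rightarrow> (nat \<Rightarrow> 'a) \<Rightarrow> bool" where
  "greedy_basis N X x \<longleftrightarrow>
     schauder_basis N X x \<and> semi_normalized N x \<and>
     (\<exists>C. \<forall>v\<in>X. \<forall>k. \<forall>\<Lambda>. finite \<Lambda> \<and> card \<Lambda> = k \<and>
        (\<forall>n\<in>\<Lambda>. \<forall>m. m \<notin> \<Lambda> \<longrightarrow> \<bar>coeff_functional N x m v\<bar> \<le> \<bar>coeff_functional N x n v\<bar>) \<longrightarrow>
        N (v - (\<Sum>n\<in>\<Lambda>. coeff_functional N x n v *\<^sub>R x n)) \<le> C * best_approx_error N x k v)"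

definition greedy_basic_sequence ::
    "('a::real_vector \<Rightarrow> real) \<Rightarrow> 'a set \<Rightarrow> (nat \<Rightarrow> 'a) \<Rightarrow> bool" where
  "greedy_basic_sequence N X x \<longleftrightarrow>
     range x \<subseteq> X \<and> greedy_basis N (closed_span N X (range x)) x"

definition equivalent_sequences ::
    "('a::real_vector \<Rightarrow> real) \<Rightarrow> (nat \<Rightarrow> 'a) \<Rightarrow> ('b::real_vector \<Rightarrow> real) \<Rightarrow> (nat \<Rightarrow> 'b) \<Rightarrow> bool"
  where
  "equivalent_sequences N x M y \<longleftrightarrow>
     (\<exists>C\<ge>1. \<forall>a :: nat \<Rightarrow> real. finite {n. a n \<noteq> 0} \<longrightarrow>
        inverse C * N (\<Sum>n | a n \<noteq> 0. a n *\<^sub>R x n) \<le> M (\<Sum>n | a n \<noteq> 0. a n *\<^sub>R y n) \<and>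
        M (\<Sum>n | a n \<noteq> 0. a n *\<^sub>R y n) \<le> C * N (\<Sum>n | a n \<noteq> 0. a n *\<^sub>R x n))"

definition isomorphic_spaces ::
    "('a::real_vector \<Rightarrow> real) \<Rightarrow> 'a set \<Rightarrow> ('b::real_vector \<Rightarrow> real) \<Rightarrow> 'b set \<Rightarrow> bool" where
  "isomorphic_spaces N X M Y \<longleftrightarrow>
     (\<exists>T. bij_betw T X Y \<and>
        (\<forall>u\<in>X. \<forall>v\<in>X. T (u + v) = T u + T v) \<and>
        (\<forall>r. \<forall>v\<in>X. T (r *\<^sub>R v) = r *\<^sub>R T v) \<and>
        (\<exists>C\<ge>1. \<forall>v\<in>X. inverse C * N v \<le> M (T v) \<and> M (T v) \<le> C * N v))"

definition equivalent_norms_on :: "'a set \<Rightarrow> ('a \<Rightarrow> real) \<Rightarrow> ('a \<Rightarrow> real) \<Rightarrow> bool" where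
  "equivalent_norms_on X N M \<longleftrightarrow> (\<exists>C\<ge>1. \<forall>v\<in>X. inverse C * N v \<le> M v \<and> M v \<le> C * N v)"

definition unit_vector :: "nat \<Rightarrow> nat \<Rightarrow> real" where
  "unit_vector n = (\<lambda>k. if k = n then 1 else 0)"

definition c0_space :: "(nat \<Rightarrow> real) set" where
  "c0_space = {a. a \<longlonglongrightarrow> 0}"

definition c0_norm :: "(nat \<Rightarrow> real) \<Rightarrow> real" where
  "c0_norm a = (SUP n. \<bar>a n\<bar>)"

text \<open>The modular takes values in \<open>[0, \<infinity>]\<close>. Since \<open>0 powr r = 0\<close> for every \<open>r\<close>, using \<open>powr\<close> is
  correct at vanishing entries for all exponents in \<open>[1, \<infinity>)\<close>.\<close>

definition nakano_modular :: "(nat \<Rightarrow> real) \<Rightarrow> (nat \<Rightarrow> real) \<Rightarrow> ennreal" where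
  "nakano_modular p a = (\<Sum>n. ennreal (\<bar>a n\<bar> powr p n))"

definition nakano_norm :: "(nat \<Rightarrow> real) \<Rightarrow> (nat \<Rightarrow> real) \<Rightarrow> real" where
  "nakano_norm p a = Inf {t. t > 0 \<and> nakano_modular p (\<lambda>n. a n / t) \<le> 1}"

definition nakano_l :: "(nat \<Rightarrow> real) \<Rightarrow> (nat \<Rightarrow> real) set" where
  "nakano_l p = {a. \<exists>t>0. nakano_modular p (\<lambda>n. a n / t) < \<infinity>}"

definition nakano_h :: "(nat \<Rightarrow> real) \<Rightarrow> (nat \<Rightarrow> real) set" where
  "nakano_h p = closed_span (nakano_norm p) (nakano_l p) (range unit_vector)"

end

theory Submission
  imports Defs
begin

text \<open>
  Let \<open>x\<close> be a greedy basis of a subspace of \<open>h\<close> and \<open>M\<close> a bound for the norms of its vectors.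
  Two consequences of the greedy inequality are used. The coefficients of a vector are bounded by a
  multiple of its norm, since removing the term with the largest coefficient increases the norm at
  most by a constant factor. And
  \<open>x\<close> is democratic with signs: if \<open>A\<close> and \<open>B\<close> are disjoint with \<open>card A \<le> card B\<close>, then
  every signed sum over \<open>A\<close> is dominated by every signed sum over \<open>B\<close>, because \<open>B\<close> is a greedy
  set of the combined sum while removing \<open>A\<close> is a competitor.

  Since the exponents tend to infinity, there are arbitrarily long signed sums of norm at most
  \<open>5 * M\<close> that avoid any given finite set of indices (\<open>bounded_signed_sums_exist\<close>): by compactness,
  two vectors \<open>x l\<close> and \<open>x m\<close> nearly agree on any initial segment, so that the differences
  \<open>x l - x m\<close> can be chosen as almost disjoint blocks which move to the right, and there the
  exponents are so large that halving a block makes its modular as small as desired. By democracy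
  all signed sums are bounded, and by convexity \<open>norm (\<Sum> a n x n)\<close> is comparable with
  \<open>max \<bar>a n\<bar>\<close>. This is the equivalence with the unit vectors of \<open>c\<^sub>0\<close>; as \<open>h\<close> is complete, it
  extends to an isomorphism of the closed span with \<open>c\<^sub>0\<close>. Conversely an isomorphism with \<open>c\<^sub>0\<close>
  transports its unit vector basis, which is greedy.

  Now suppose that \<open>h\<close> itself has a greedy basis \<open>x\<close>. Let \<open>A\<close> be the finite set of indices with
  exponents in \<open>[2, k]\<close>. The coordinate projection onto \<open>A\<close> factors through \<open>c\<^sub>0\<close> by means of \<open>x\<close>,
  and has trace \<open>card A\<close>. On \<open>A\<close> the Nakano norm is at most the \<open>\<ell>\<^sub>2\<close>-norm, hence by Khintchine's
  inequality at most four times the average of the signed sums of the coordinates. Computing the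
  trace in the basis \<open>x\<close> then gives \<open>card A \<le> const * W\<close>, where \<open>W\<close> is the supremum of
  \<open>\<Sum>i\<in>A. \<bar>v i\<bar>\<close> over the unit ball (\<open>trace_estimate\<close>). At most \<open>1 / t ^ k\<close> coordinates in \<open>A\<close> of
  a vector in the unit ball exceed \<open>t\<close>, so \<open>W \<le> t * card A + 1 / t ^ k\<close>, and a small \<open>t\<close> shows that
  \<open>card A\<close> grows at most geometrically in \<open>k\<close>. Therefore \<open>\<Sum>i. r powr p i < \<infinity>\<close> for some
  \<open>r > 0\<close>, which makes the Nakano norm equivalent to the supremum norm and \<open>h\<close> equal to \<open>c\<^sub>0\<close>.
\<close>

section \<open>Norms on linear subspaces\<close>

lemma norm_closureE:
  assumes "v \<in> norm_closure N X S" "\<epsilon> > 0"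
  obtains u where "u \<in> S" "N (v - u) < \<epsilon>"
  using assms unfolding norm_closure_def by blast

locale normed_subspace =
  fixes N :: "'a::real_vector \<Rightarrow> real" and X :: "'a set"
  assumes carrier_subspace: "subspace X"
    and norm_triangle: "u \<in> X \<Longrightarrow> v \<in> X \<Longrightarrow> N (u + v) \<le> N u + N v"
    and norm_scale: "u \<in> X \<Longrightarrow> N (c *\<^sub>R u) = \<bar>c\<bar> * N u"
    and norm_definite: "u \<in> X \<Longrightarrow> N u = 0 \<Longrightarrow> u = 0"
begin

lemmas carrier_0 = subspace_0[OF carrier_subspace]
lemmas carrier_add = subspace_add[OF carrier_subspace]
lemmas carrier_diff = subspace_diff[OF carrier_subspace]
lemmas carrier_scale = subspace_scale[OF carrier_subspace]
lemmas carrier_sum = subspace_sum[OF carrier_subspace]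
lemmas carrier_closed = carrier_0 carrier_add carrier_diff carrier_scale carrier_sum

lemma norm_0: "N 0 = 0"
  using norm_scale[OF carrier_0, of 0] by simp

lemma norm_minus: "u \<in> X \<Longrightarrow> N (- u) = N u"
  using norm_scale[of u "-1"] by simp

lemma norm_diff_commute: "u \<in> X \<Longrightarrow> v \<in> X \<Longrightarrow> N (u - v) = N (v - u)"
  using norm_minus[of "u - v"] carrier_diff by simp

lemma norm_triangle_diff: "u \<in> X \<Longrightarrow> v \<in> X \<Longrightarrow> N (u - v) \<le> N u + N v"
  using norm_triangle[of u "- v"] norm_minus[of v] subspace_neg[OF carrier_subspace] by simp

lemma norm_nonneg: "u \<in> X \<Longrightarrow> 0 \<le> N u"
  using norm_triangle_diff[of u u] norm_0 by simp

lemma norm_diff_triangle: "u \<in> X \<Longrightarrow> v \<in> X \<Longrightarrow> w \<in> X \<Longrightarrow> N (u - w) \<le> N (u - v) + N (v - w)"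
  using norm_triangle[of "u - v" "v - w"] carrier_diff by simp

lemma norm_abs_diff: "u \<in> X \<Longrightarrow> v \<in> X \<Longrightarrow> \<bar>N u - N v\<bar> \<le> N (u - v)"
  using norm_triangle[of "u - v" v] norm_triangle[of "v - u" u] norm_diff_commute[of u v] carrier_diff
  by (simp add: abs_le_iff)

lemma norm_sum_le:
  "(\<And>i. i \<in> A \<Longrightarrow> f i \<in> X) \<Longrightarrow> N (\<Sum>i\<in>A. f i) \<le> (\<Sum>i\<in>A. N (f i))"
proof (induction A rule: infinite_finite_induct)
  case (insert a A)
  have "N (f a + sum f A) \<le> N (f a) + N (sum f A)"
    using insert by (intro norm_triangle carrier_sum) auto
  with insert show ?case by simp
qed (simp_all add: norm_0)

lemma subspace_norm_closure:
  assumes S: "subspace S" "S \<subseteq> X"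
  shows "subspace (norm_closure N X S)"
proof (rule subspaceI)
  show "0 \<in> norm_closure N X S"
    using S subspace_0[OF S(1)] by (auto simp: norm_closure_def carrier_0 norm_0 intro!: bexI[of _ 0])
next
  fix v w assume vw: "v \<in> norm_closure N X S" "w \<in> norm_closure N X S"
  then have X: "v \<in> X" "w \<in> X" by (auto simp: norm_closure_def)
  have "\<exists>u\<in>S. N (v + w - u) < \<epsilon>" if "\<epsilon> > 0" for \<epsilon>
  proof -
    have "\<epsilon>/2 > 0" using that by simp
    then obtain u1 u2 where u: "u1 \<in> S" "u2 \<in> S" "N (v - u1) < \<epsilon>/2" "N (w - u2) < \<epsilon>/2"
      using norm_closureE[OF vw(1)] norm_closureE[OF vw(2)] by metis
    have "N ((v - u1) + (w - u2)) \<le> N (v - u1) + N (w - u2)"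
      using u X S by (intro norm_triangle carrier_diff) auto
    then have "N (v + w - (u1 + u2)) < \<epsilon>"
      using u by (simp add: algebra_simps)
    then show ?thesis using u subspace_add[OF S(1)] by blast
  qed
  then show "v + w \<in> norm_closure N X S"
    using X carrier_add by (auto simp: norm_closure_def)
next
  fix c v assume v: "v \<in> norm_closure N X S"
  then have X: "v \<in> X" by (auto simp: norm_closure_def)
  have "\<exists>u\<in>S. N (c *\<^sub>R v - u) < \<epsilon>" if "\<epsilon> > 0" for \<epsilon>
  proof -
    have "\<epsilon> / (\<bar>c\<bar> + 1) > 0" using that by simp
    then obtain u where u: "u \<in> S" "N (v - u) < \<epsilon> / (\<bar>c\<bar> + 1)"
      by (rule norm_closureE[OF v])
    have uX: "v - u \<in> X" using u X S carrier_diff by auto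
    have "N (c *\<^sub>R v - c *\<^sub>R u) = \<bar>c\<bar> * N (v - u)"
      using norm_scale[OF uX] by (simp add: algebra_simps)
    also have "\<dots> \<le> (\<bar>c\<bar> + 1) * N (v - u)" using norm_nonneg[OF uX] by (simp add: algebra_simps)
    also have "\<dots> < \<epsilon>" using u(2) by (simp add: field_simps)
    finally show ?thesis using u(1) subspace_scale[OF S(1)] by blast
  qed
  then show "c *\<^sub>R v \<in> norm_closure N X S"
    using X carrier_scale by (auto simp: norm_closure_def)
qed

lemma subset_norm_closure: "S \<subseteq> X \<Longrightarrow> S \<subseteq> norm_closure N X S"
  using norm_0 by (force simp: norm_closure_def)

lemma norm_closure_subset: "norm_closure N X S \<subseteq> X"
  by (auto simp: norm_closure_def)

lemma norm_closure_idem: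
  assumes "S \<subseteq> X" "Z \<subseteq> X" "v \<in> norm_closure N Z (norm_closure N X S)"
  shows "v \<in> norm_closure N X S"
proof -
  have v: "v \<in> X" using assms by (auto simp: norm_closure_def)
  have "\<exists>u\<in>S. N (v - u) < \<epsilon>" if "\<epsilon> > 0" for \<epsilon>
  proof -
    have e: "\<epsilon>/2 > 0" using that by simp
    obtain w where w: "w \<in> norm_closure N X S" "N (v - w) < \<epsilon>/2"
      by (rule norm_closureE[OF assms(3) e])
    obtain u where u: "u \<in> S" "N (w - u) < \<epsilon>/2"
      by (rule norm_closureE[OF w(1) e])
    have "N (v - u) \<le> N (v - w) + N (w - u)"
      using v w(1) u assms(1) norm_closure_subset by (intro norm_diff_triangle) auto
    then show ?thesis using w u by (intro bexI[of _ u]) auto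
  qed
  then show ?thesis using v by (auto simp: norm_closure_def)
qed

section \<open>Expansions\<close>

lemma combination_in_carrier: "range x \<subseteq> X \<Longrightarrow> (\<Sum>n\<in>F. a n *\<^sub>R x n) \<in> X"
  by (auto intro!: carrier_sum carrier_scale)

lemma expansion_determines_vector:
  assumes "range x \<subseteq> X" "v \<in> X" "w \<in> X" "is_expansion N x v a" "is_expansion N x w a"
  shows "v = w"
proof -
  have "N (v - w) \<le> N (v - (\<Sum>n<m. a n *\<^sub>R x n)) + N (w - (\<Sum>n<m. a n *\<^sub>R x n))" for m
    using norm_diff_triangle[OF assms(2) combination_in_carrier[OF assms(1)] assms(3)]
      norm_diff_commute[OF assms(3) combination_in_carrier[OF assms(1)]] by metis
  moreover have "(\<lambda>m. N (v - (\<Sum>n<m. a n *\<^sub>R x n)) + N (w - (\<Sum>n<m. a n *\<^sub>R x n))) \<longlonglongrightarrow> 0 + 0"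
    using assms(4,5) unfolding is_expansion_def by (intro tendsto_add)
  ultimately have "N (v - w) \<le> 0 + 0"
    by (intro LIMSEQ_le_const) auto
  then show ?thesis
    using norm_nonneg[of "v - w"] norm_definite[of "v - w"] assms(2,3) carrier_diff by force
qed

lemma expansion_norm_limit:
  assumes "range x \<subseteq> X" "v \<in> X" "is_expansion N x v a"
  shows "(\<lambda>m. N (\<Sum>n<m. a n *\<^sub>R x n)) \<longlonglongrightarrow> N v"
proof -
  have "\<bar>N (\<Sum>n<m. a n *\<^sub>R x n) - N v\<bar> \<le> N (v - (\<Sum>n<m. a n *\<^sub>R x n))" for m
    using norm_abs_diff[OF assms(2) combination_in_carrier[OF assms(1)]]
    by (subst abs_minus_commute)
  then have "\<forall>\<^sub>F m in sequentially. norm (N (\<Sum>n<m. a n *\<^sub>R x n) - N v) \<le> N (v - (\<Sum>n<m. a n *\<^sub>R x n))"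
    by (intro always_eventually allI) (simp only: real_norm_def)
  from Lim_null_comparison[OF this assms(3)[unfolded is_expansion_def]]
  have "(\<lambda>m. N (\<Sum>n<m. a n *\<^sub>R x n) - N v) \<longlonglongrightarrow> 0" .
  then show ?thesis by (simp add: LIM_zero_cancel)
qed

lemma expansion_finite_sum:
  assumes "finite F"
  shows "is_expansion N x (\<Sum>n\<in>F. a n *\<^sub>R x n) (\<lambda>n. if n \<in> F then a n else 0)"
proof -
  obtain M where M: "F \<subseteq> {..<M}"
    using assms by (metis finite_nat_iff_bounded)
  have "(\<Sum>n\<in>F. a n *\<^sub>R x n) = (\<Sum>n<m. (if n \<in> F then a n else 0) *\<^sub>R x n)" if "m \<ge> M" for m
    using M that by (intro sum.mono_neutral_cong_left) auto
  then have "eventually (\<lambda>m. N ((\<Sum>n\<in>F. a n *\<^sub>R x n) -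
      (\<Sum>n<m. (if n \<in> F then a n else 0) *\<^sub>R x n)) = 0) sequentially"
    unfolding eventually_sequentially using norm_0 by (intro exI[of _ M]) (metis diff_self)
  then show ?thesis
    unfolding is_expansion_def by (rule tendsto_eventually)
qed

lemma expansion_scale:
  assumes "range x \<subseteq> X" "v \<in> X" "is_expansion N x v a"
  shows "is_expansion N x (r *\<^sub>R v) (\<lambda>n. r * a n)"
proof -
  have "N (r *\<^sub>R v - (\<Sum>n<m. (r * a n) *\<^sub>R x n)) = \<bar>r\<bar> * N (v - (\<Sum>n<m. a n *\<^sub>R x n))" for m
  proof -
    have "v - (\<Sum>n<m. a n *\<^sub>R x n) \<in> X"
      using assms(1,2) by (auto intro!: carrier_closed)
    from norm_scale[OF this, of r] show ?thesis
      by (simp add: scaleR_right_diff_distrib scaleR_sum_right)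
  qed
  moreover have "(\<lambda>m. \<bar>r\<bar> * N (v - (\<Sum>n<m. a n *\<^sub>R x n))) \<longlonglongrightarrow> \<bar>r\<bar> * 0"
    using assms(3) unfolding is_expansion_def by (intro tendsto_mult_left)
  ultimately show ?thesis by (simp add: is_expansion_def)
qed

lemma expansion_sum:
  assumes "range x \<subseteq> X" "\<And>i. i \<in> A \<Longrightarrow> v i \<in> X \<and> is_expansion N x (v i) (a i)"
  shows "is_expansion N x (\<Sum>i\<in>A. v i) (\<lambda>n. \<Sum>i\<in>A. a i n)"
proof -
  let ?g = "\<lambda>i m. v i - (\<Sum>n<m. a i n *\<^sub>R x n)"
  have eq: "(\<Sum>i\<in>A. v i) - (\<Sum>n<m. (\<Sum>i\<in>A. a i n) *\<^sub>R x n) = (\<Sum>i\<in>A. ?g i m)" for m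
    by (subst sum_subtractf, subst sum.swap) (simp add: scaleR_sum_left)
  have X: "?g i m \<in> X" if "i \<in> A" for i m
    using assms that by (auto intro!: carrier_closed)
  have "(\<lambda>m. \<Sum>i\<in>A. N (?g i m)) \<longlonglongrightarrow> (\<Sum>i\<in>A. 0)"
    using assms(2) by (intro tendsto_sum) (auto simp: is_expansion_def)
  then have lim: "(\<lambda>m. \<Sum>i\<in>A. N (?g i m)) \<longlonglongrightarrow> 0" by simp
  show ?thesis
    unfolding is_expansion_def eq
  proof (rule tendsto_sandwich[OF _ _ tendsto_const lim])
    show "\<forall>\<^sub>F m in sequentially. 0 \<le> N (\<Sum>i\<in>A. ?g i m)"
      using X by (auto intro!: always_eventually norm_nonneg carrier_sum)
    show "\<forall>\<^sub>F m in sequentially. N (\<Sum>i\<in>A. ?g i m) \<le> (\<Sum>i\<in>A. N (?g i m))"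
      using X by (auto intro!: always_eventually norm_sum_le)
  qed
qed

text \<open>A convex function on a cube is bounded by its values at the vertices. The coordinates are moved
  to the end points one at a time; the vector \<open>v\<close> collects those that are already there.\<close>

lemma signs_control_cube:
  assumes "finite A" "v \<in> X" "\<And>n. n \<in> A \<Longrightarrow> y n \<in> X"
    and "\<And>\<epsilon>. (\<And>n. \<bar>\<epsilon> n\<bar> = 1) \<Longrightarrow> N (v + (\<Sum>n\<in>A. \<epsilon> n *\<^sub>R y n)) \<le> K"
    and "\<And>n. n \<in> A \<Longrightarrow> \<bar>a n\<bar> \<le> (1::real)"
  shows "N (v + (\<Sum>n\<in>A. a n *\<^sub>R y n)) \<le> K"
  using assms
proof (induction A arbitrary: v rule: finite_induct)
  case empty
  then show ?case by (force intro: empty.prems(3)[of "\<lambda>_. 1", simplified])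
next
  case (insert i A)
  have ends: "N (v + \<delta> *\<^sub>R y i + (\<Sum>n\<in>A. a n *\<^sub>R y n)) \<le> K" if "\<bar>\<delta>\<bar> = 1" for \<delta>
  proof (rule insert.IH)
    show "v + \<delta> *\<^sub>R y i \<in> X" using insert.prems by (auto intro!: carrier_closed)
    fix \<epsilon> :: "'b \<Rightarrow> real" assume "\<And>n. \<bar>\<epsilon> n\<bar> = 1"
    then have "N (v + (\<Sum>n\<in>insert i A. (\<epsilon>(i := \<delta>)) n *\<^sub>R y n)) \<le> K"
      using that by (intro insert.prems(3)) auto
    moreover have "(\<Sum>n\<in>A. (\<epsilon>(i := \<delta>)) n *\<^sub>R y n) = (\<Sum>n\<in>A. \<epsilon> n *\<^sub>R y n)"
      using insert.hyps by (intro sum.cong) auto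
    ultimately show "N (v + \<delta> *\<^sub>R y i + (\<Sum>n\<in>A. \<epsilon> n *\<^sub>R y n)) \<le> K"
      using insert.hyps by (simp add: add.assoc)
  qed (use insert.prems in auto)
  define w where "w = v + (\<Sum>n\<in>A. a n *\<^sub>R y n)"
  \<comment> \<open>\<open>a i\<close> is the mean of \<open>1\<close> and \<open>- 1\<close> with weights \<open>t\<close> and \<open>1 - t\<close>.\<close>
  define t where "t = (1 + a i) / 2"
  have t: "0 \<le> t" "t \<le> 1" using insert.prems(4)[of i] by (auto simp: t_def)
  have yi: "y i \<in> X" using insert.prems by auto
  have w: "w \<in> X" unfolding w_def using insert.prems by (auto intro!: carrier_closed)
  have wp: "w + y i \<in> X" "w - y i \<in> X" using w yi carrier_add carrier_diff by auto
  have b: "N (w + y i) \<le> K" "N (w - y i) \<le> K"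
    using ends[of 1] ends[of "-1"] by (simp_all add: w_def algebra_simps)
  have "v + (\<Sum>n\<in>insert i A. a n *\<^sub>R y n) = w + a i *\<^sub>R y i"
    using insert.hyps by (simp add: w_def add_ac)
  also have "a i = t - (1 - t)" by (simp add: t_def field_simps)
  also have "w + (t - (1 - t)) *\<^sub>R y i = t *\<^sub>R (w + y i) + (1 - t) *\<^sub>R (w - y i)"
    by (simp add: algebra_simps flip: scaleR_add_left)
  finally have "N (v + (\<Sum>n\<in>insert i A. a n *\<^sub>R y n)) \<le> N (t *\<^sub>R (w + y i)) + N ((1 - t) *\<^sub>R (w - y i))"
    using norm_triangle wp carrier_scale by metis
  also have "\<dots> = t * N (w + y i) + (1 - t) * N (w - y i)"
    using t wp by (simp add: norm_scale)
  also have "\<dots> \<le> t * K + (1 - t) * K"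
    using t b by (intro add_mono mult_left_mono) auto
  finally show ?case by (simp add: algebra_simps)
qed

end

lemma coeff_functional_eq:
  assumes "schauder_basis N Y x" "v \<in> Y" "is_expansion N x v a"
  shows "coeff_functional N x n v = a n"
proof -
  have "(THE a. is_expansion N x v a) = a"
    using assms by (intro the1_equality) (auto simp: schauder_basis_def)
  then show ?thesis by (simp add: coeff_functional_def)
qed

section \<open>Greedy bases\<close>

context normed_subspace
begin

lemma best_approx_error_le:
  assumes "range x \<subseteq> X" "v \<in> X" "finite A" "card A = k"
  shows "best_approx_error N x k v \<le> N (v - (\<Sum>n\<in>A. \<alpha> n *\<^sub>R x n))"
  unfolding best_approx_error_def
proof (rule cInf_lower)
  show "bdd_below {N (v - (\<Sum>n\<in>A. \<alpha> n *\<^sub>R x n)) |A \<alpha>. finite A \<and> card A = k}"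
    using assms(1,2) by (intro bdd_belowI[of _ 0]) (auto intro!: norm_nonneg carrier_closed)
qed (use assms in auto)

lemma le_best_approx_error:
  assumes "\<And>A \<alpha>. finite A \<Longrightarrow> card A = k \<Longrightarrow> e \<le> N (v - (\<Sum>n\<in>A. \<alpha> n *\<^sub>R x n))"
  shows "e \<le> best_approx_error N x k v"
  unfolding best_approx_error_def
proof (rule cInf_greatest)
  have "finite {..<k} \<and> card {..<k} = k" by simp
  then show "{N (v - (\<Sum>n\<in>A. \<alpha> n *\<^sub>R x n)) |A \<alpha>. finite A \<and> card A = k} \<noteq> {}" by blast
  fix r assume "r \<in> {N (v - (\<Sum>n\<in>A. \<alpha> n *\<^sub>R x n)) |A \<alpha>. finite A \<and> card A = k}"
  then show "e \<le> r" using assms by blast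
qed

text \<open>Approximating by a set with fewer elements is also allowed because missing indices can be
  added with coefficient zero.\<close>

text \<open>The greedy inequality restricted to finitely supported vectors, where the coefficients are
  visible. The competitors are only the partial sums over sets with at most \<open>card \<Lambda>\<close> elements.\<close>

definition greedy_constant :: "(nat \<Rightarrow> 'a) \<Rightarrow> real \<Rightarrow> bool" where
  "greedy_constant x C \<longleftrightarrow> 0 \<le> C \<and> (\<forall>F \<Lambda> A a. finite F \<and> \<Lambda> \<subseteq> F \<and> A \<subseteq> F \<and> card A \<le> card \<Lambda> \<and>
     (\<forall>n\<in>\<Lambda>. \<forall>m\<in>F - \<Lambda>. \<bar>a m\<bar> \<le> \<bar>a n\<bar>) \<longrightarrow>
     N (\<Sum>n\<in>F - \<Lambda>. a n *\<^sub>R x n) \<le> C * N (\<Sum>n\<in>F - A. a n *\<^sub>R x n))"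

lemma greedy_constantD:
  assumes "greedy_constant x C" "finite F" "\<Lambda> \<subseteq> F" "A \<subseteq> F" "card A \<le> card \<Lambda>"
    and "\<And>n m. n \<in> \<Lambda> \<Longrightarrow> m \<in> F - \<Lambda> \<Longrightarrow> \<bar>a m\<bar> \<le> \<bar>a n\<bar>"
  shows "N (\<Sum>n\<in>F - \<Lambda>. a n *\<^sub>R x n) \<le> C * N (\<Sum>n\<in>F - A. a n *\<^sub>R x n)"
  using assms(1)[unfolded greedy_constant_def, THEN conjunct2, rule_format, of F \<Lambda> A a] assms(2-) by simp

lemma greedy_basis_has_greedy_constant:
  assumes Y: "subspace Y" "Y \<subseteq> X" and x: "greedy_basis N Y x"
  shows "\<exists>C. greedy_constant x C"
proof -
  from x have sb: "schauder_basis N Y x" by (simp add: greedy_basis_def)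
  from x obtain C0 where C0: "\<forall>v\<in>Y. \<forall>k. \<forall>\<Lambda>. finite \<Lambda> \<and> card \<Lambda> = k \<and>
      (\<forall>n\<in>\<Lambda>. \<forall>m. m \<notin> \<Lambda> \<longrightarrow> \<bar>coeff_functional N x m v\<bar> \<le> \<bar>coeff_functional N x n v\<bar>) \<longrightarrow>
      N (v - (\<Sum>n\<in>\<Lambda>. coeff_functional N x n v *\<^sub>R x n)) \<le> C0 * best_approx_error N x k v"
    unfolding greedy_basis_def by (elim conjE exE)
  have xY: "x n \<in> Y" for n using sb by (auto simp: schauder_basis_def)
  have xX: "range x \<subseteq> X" using xY Y by auto
  have "N (\<Sum>n\<in>F - \<Lambda>. a n *\<^sub>R x n) \<le> \<bar>C0\<bar> * N (\<Sum>n\<in>F - A. a n *\<^sub>R x n)"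
    if F: "finite F" "\<Lambda> \<subseteq> F" "A \<subseteq> F" "card A \<le> card \<Lambda>"
      and greedy: "\<forall>n\<in>\<Lambda>. \<forall>m\<in>F - \<Lambda>. \<bar>a m\<bar> \<le> \<bar>a n\<bar>"
    for F \<Lambda> A :: "nat set" and a :: "nat \<Rightarrow> real"
  proof -
    define v where "v = (\<Sum>n\<in>F. a n *\<^sub>R x n)"
    have vY: "v \<in> Y" unfolding v_def using xY by (intro subspace_sum subspace_scale Y)
    have coeff: "coeff_functional N x n v = (if n \<in> F then a n else 0)" for n
      unfolding v_def by (rule coeff_functional_eq[OF sb]) 
        (use vY expansion_finite_sum[OF F(1)] in \<open>auto simp: v_def\<close>)
    have fin: "finite \<Lambda>" "finite A" using F finite_subset by auto
    \<comment> \<open>A competitor must have exactly \<open>card \<Lambda>\<close> indices, so \<open>A\<close> is enlarged by indices with coefficient zero.\<close>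
    have "infinite (UNIV - A)" using fin(2) by simp
    then obtain B where B: "B \<subseteq> UNIV - A" "finite B" "card B = card \<Lambda> - card A"
      using infinite_arbitrarily_large by blast
    define A' where "A' = A \<union> B"
    have A': "finite A'" "card A' = card \<Lambda>"
      using B fin F card_Un_disjoint[of A B] by (auto simp: A'_def)
    have split: "v - (\<Sum>n\<in>G. (if n \<in> D then a n else 0) *\<^sub>R x n) = (\<Sum>n\<in>F - D. a n *\<^sub>R x n)"
      if "D \<subseteq> F" "D \<subseteq> G" "finite G" for D G
    proof -
      have "(\<Sum>n\<in>G. (if n \<in> D then a n else 0) *\<^sub>R x n) = (\<Sum>n\<in>D. a n *\<^sub>R x n)"
        using that by (intro sum.mono_neutral_cong_right) auto
      then show ?thesis unfolding v_def sum_diff[OF F(1) that(1)] by (rule arg_cong)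
    qed
    let ?b = "best_approx_error N x (card \<Lambda>) v"
    have "(\<Sum>n\<in>\<Lambda>. coeff_functional N x n v *\<^sub>R x n) = (\<Sum>n\<in>\<Lambda>. (if n \<in> \<Lambda> then a n else 0) *\<^sub>R x n)"
      using F by (intro sum.cong) (auto simp: coeff)
    then have e1: "v - (\<Sum>n\<in>\<Lambda>. coeff_functional N x n v *\<^sub>R x n) = (\<Sum>n\<in>F - \<Lambda>. a n *\<^sub>R x n)"
      using split[OF F(2) subset_refl fin(1)] by (simp only:)
    have "\<bar>coeff_functional N x m v\<bar> \<le> \<bar>coeff_functional N x n v\<bar>" if "n \<in> \<Lambda>" "m \<notin> \<Lambda>" for n m
      unfolding coeff using that F(2) subsetD[OF F(2) that(1)] bspec[OF bspec[OF greedy that(1)], of m] by simp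
    then have e2: "N (\<Sum>n\<in>F - \<Lambda>. a n *\<^sub>R x n) \<le> C0 * ?b"
      unfolding e1[symmetric] using fin(1) by (intro C0[rule_format] vY) simp
    have vX: "v \<in> X" using vY Y by auto
    have "0 \<le> ?b"
      by (intro le_best_approx_error norm_nonneg carrier_diff vX combination_in_carrier xX)
    then have e3: "C0 * ?b \<le> \<bar>C0\<bar> * ?b"
      by (intro mult_right_mono) auto
    have "?b \<le> N (v - (\<Sum>n\<in>A'. (if n \<in> A then a n else 0) *\<^sub>R x n))"
      by (intro best_approx_error_le xX vX A')
    also have "v - (\<Sum>n\<in>A'. (if n \<in> A then a n else 0) *\<^sub>R x n) = (\<Sum>n\<in>F - A. a n *\<^sub>R x n)"
      by (rule split[OF F(3) _ A'(1)]) (simp add: A'_def)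
    finally have "\<bar>C0\<bar> * ?b \<le> \<bar>C0\<bar> * N (\<Sum>n\<in>F - A. a n *\<^sub>R x n)"
      by (intro mult_left_mono) auto
    with e2 e3 show "N (\<Sum>n\<in>F - \<Lambda>. a n *\<^sub>R x n) \<le> \<bar>C0\<bar> * N (\<Sum>n\<in>F - A. a n *\<^sub>R x n)"
      by linarith
  qed
  then have "greedy_constant x \<bar>C0\<bar>"
    unfolding greedy_constant_def by (intro conjI allI impI) (simp, elim conjE)
  then show ?thesis ..
qed

text \<open>If \<open>k\<close> carries the largest coefficient, then \<open>{k}\<close> is a greedy set and the empty set is a
  competitor. So removing \<open>a k *\<^sub>R x k\<close> increases the norm at most by a constant factor, and the norm
  of the removed term is controlled.\<close>

lemma greedy_coefficients_bounded:
  assumes x: "range x \<subseteq> X" "semi_normalized N x" and C: "greedy_constant x C"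
  shows "\<exists>D\<ge>0. \<forall>F a. finite F \<longrightarrow> (\<forall>n\<in>F. \<bar>a n\<bar> \<le> D * N (\<Sum>n\<in>F. a n *\<^sub>R x n))"
proof -
  obtain c where c: "c > 0" "\<And>n. c \<le> N (x n)"
    using x(2) by (auto simp: semi_normalized_def)
  have C0: "C \<ge> 0" using C by (simp add: greedy_constant_def)
  have "\<bar>a n\<bar> \<le> (1 + C) / c * N (\<Sum>n\<in>F. a n *\<^sub>R x n)" if F: "finite F" "n \<in> F" for F a n
  proof -
    have "Max ((\<lambda>m. \<bar>a m\<bar>) ` F) \<in> (\<lambda>m. \<bar>a m\<bar>) ` F" using F by (intro Max_in) auto
    then obtain k where "k \<in> F" "\<bar>a k\<bar> = Max ((\<lambda>m. \<bar>a m\<bar>) ` F)" by (metis imageE)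
    then have k: "k \<in> F" "\<And>m. m \<in> F \<Longrightarrow> \<bar>a m\<bar> \<le> \<bar>a k\<bar>" using F by auto
    let ?s = "\<lambda>F. \<Sum>n\<in>F. a n *\<^sub>R x n"
    have s: "?s F \<in> X" "?s (F - {k}) \<in> X" using x combination_in_carrier by auto
    have "N (?s (F - {k})) \<le> C * N (?s (F - {}))"
      by (rule greedy_constantD[OF C]) (use F k in auto)
    moreover have "?s F - ?s (F - {k}) = a k *\<^sub>R x k"
      using F k by (simp add: sum_diff1)
    moreover have "N (a k *\<^sub>R x k) = \<bar>a k\<bar> * N (x k)"
      using x by (intro norm_scale) auto
    ultimately have "\<bar>a k\<bar> * N (x k) \<le> (1 + C) * N (?s F)"
      using norm_triangle_diff[OF s] by (simp add: algebra_simps)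
    moreover have "\<bar>a n\<bar> * c \<le> \<bar>a k\<bar> * N (x k)"
      using k(2)[OF F(2)] c(1) c(2)[of k] by (intro mult_mono) auto
    ultimately show ?thesis
      using c(1) by (simp add: field_simps)
  qed
  moreover have "(1 + C) / c \<ge> 0" using C0 c(1) by simp
  ultimately show ?thesis by blast
qed

text \<open>In the sum over \<open>A \<union> B\<close> all coefficients have modulus one, so \<open>B\<close> is a greedy set, and \<open>A\<close>
  competes with it.\<close>

lemma greedy_democracy:
  assumes C: "greedy_constant x C"
    and A: "finite A" "finite B" "A \<inter> B = {}" "card A \<le> card B"
    and signs: "\<And>n. n \<in> A \<union> B \<Longrightarrow> \<bar>a n\<bar> = 1"
  shows "N (\<Sum>n\<in>A. a n *\<^sub>R x n) \<le> C * N (\<Sum>n\<in>B. a n *\<^sub>R x n)"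
proof -
  have "N (\<Sum>n\<in>(A \<union> B) - B. a n *\<^sub>R x n) \<le> C * N (\<Sum>n\<in>(A \<union> B) - A. a n *\<^sub>R x n)"
    by (rule greedy_constantD[OF C]) (use A signs in auto)
  moreover have "(A \<union> B) - B = A" "(A \<union> B) - A = B" using A by auto
  ultimately show ?thesis by simp
qed

end

section \<open>Nakano spaces\<close>

lemma sum_fun_apply: "(\<Sum>i\<in>A. f i) k = (\<Sum>i\<in>A. f i k)"
  by (induction A rule: infinite_finite_induct) auto

lemma scaleR_seq_apply [simp]: "(c *\<^sub>R f) k = c * f k" for f :: "'a \<Rightarrow> real"
  by (simp add: scaleR_fun_def)

lemma combination_apply: "(\<Sum>n\<in>F. a n *\<^sub>R x n) k = (\<Sum>n\<in>F. a n * x n k)"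
  for x :: "'b \<Rightarrow> 'a \<Rightarrow> real"
  by (simp add: sum_fun_apply)

text \<open>Scaling by \<open>c \<le> 1\<close> gains a factor which gets smaller with the exponent: \<open>q = 1\<close> is
  convexity along rays from zero, and large \<open>q\<close> is the gain from exponents that tend to infinity.\<close>

lemma powr_contract:
  fixes c y :: real
  assumes "0 \<le> c" "c \<le> 1" "q \<le> r"
  shows "\<bar>c * y\<bar> powr r \<le> c powr q * \<bar>y\<bar> powr r"
proof -
  have "\<bar>c * y\<bar> powr r = c powr r * \<bar>y\<bar> powr r"
    using assms by (simp add: abs_mult powr_mult)
  also have "\<dots> \<le> c powr q * \<bar>y\<bar> powr r"
    using assms by (intro mult_right_mono powr_mono') auto
  finally show ?thesis .
qed

lemma powr_convex_combination:
  fixes x y :: real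
  assumes "x \<ge> 0" "y \<ge> 0" "0 \<le> t" "t \<le> 1" "1 \<le> r"
  shows "(t * x + (1 - t) * y) powr r \<le> t * x powr r + (1 - t) * y powr r"
proof -
  consider "x = 0" | "y = 0" | "x > 0" "y > 0" using assms by linarith
  then show ?thesis
  proof cases
    case 1
    then show ?thesis using powr_contract[of "1 - t" 1 r y] assms by simp
  next
    case 2
    then show ?thesis using powr_contract[of t 1 r x] assms by simp
  next
    case 3
    have "((1 - (1 - t)) *\<^sub>R x + (1 - t) *\<^sub>R y) powr r \<le> (1 - (1 - t)) * x powr r + (1 - t) * y powr r"
      using 3 assms by (intro convex_onD[OF powr_convex]) auto
    then show ?thesis by simp
  qed
qed

text \<open>The inequality between the modular and a real number, in terms of real finite sums instead of
  values in \<open>[0, \<infinity>]\<close>.\<close>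

definition modular_bounded :: "(nat \<Rightarrow> real) \<Rightarrow> real \<Rightarrow> (nat \<Rightarrow> real) \<Rightarrow> bool" where
  "modular_bounded p c a \<longleftrightarrow> (\<forall>F. finite F \<longrightarrow> (\<Sum>i\<in>F. \<bar>a i\<bar> powr p i) \<le> c)"

lemma nakano_modular_le_iff:
  assumes "c \<ge> 0"
  shows "nakano_modular p a \<le> ennreal c \<longleftrightarrow> modular_bounded p c a"
proof
  assume L: "nakano_modular p a \<le> ennreal c"
  show "modular_bounded p c a"
    unfolding modular_bounded_def
  proof (intro allI impI)
    fix F :: "nat set" assume "finite F"
    have "ennreal (\<Sum>i\<in>F. \<bar>a i\<bar> powr p i) = (\<Sum>i\<in>F. ennreal (\<bar>a i\<bar> powr p i))"
      by (simp add: sum_ennreal)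
    also have "\<dots> \<le> nakano_modular p a"
      unfolding nakano_modular_def using \<open>finite F\<close> by (intro sum_le_suminf) auto
    finally show "(\<Sum>i\<in>F. \<bar>a i\<bar> powr p i) \<le> c"
      using L assms by (metis ennreal_le_iff order_trans)
  qed
next
  assume R: "modular_bounded p c a"
  have "(\<Sum>i<n. ennreal (\<bar>a i\<bar> powr p i)) \<le> ennreal c" for n
    using R assms by (simp add: sum_ennreal modular_bounded_def ennreal_leI)
  then show "nakano_modular p a \<le> ennreal c"
    unfolding nakano_modular_def by (intro suminf_le_const) auto
qed

definition restrict_seq :: "nat set \<Rightarrow> (nat \<Rightarrow> real) \<Rightarrow> nat \<Rightarrow> real" where
  "restrict_seq A a = (\<lambda>i. if i \<in> A then a i else 0)"

lemma restrict_seq_eq_sum: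
  "finite A \<Longrightarrow> restrict_seq A a = (\<Sum>n\<in>A. a n *\<^sub>R unit_vector n)"
  by (auto simp: fun_eq_iff combination_apply restrict_seq_def unit_vector_def if_distrib cong: if_cong)

locale nakano_space =
  fixes p :: "nat \<Rightarrow> real"
  assumes p_ge_1: "1 \<le> p n"
begin

abbreviation "NN \<equiv> nakano_norm p"

text \<open>The sublevel sets whose Minkowski functional is the Nakano norm. Triangle inequality, homogeneity
  and monotonicity are proved for these sets and then passed to the infimum.\<close>

definition gauge_ball :: "real \<Rightarrow> (nat \<Rightarrow> real) \<Rightarrow> bool" where
  "gauge_ball t a \<longleftrightarrow> t > 0 \<and> modular_bounded p 1 (\<lambda>i. a i / t)"

lemma nakano_norm_eq: "NN a = Inf {t. gauge_ball t a}"
  using nakano_modular_le_iff[of 1 p] by (simp add: nakano_norm_def gauge_ball_def)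

lemma gauge_ballD: "gauge_ball t a \<Longrightarrow> finite F \<Longrightarrow> (\<Sum>i\<in>F. \<bar>a i / t\<bar> powr p i) \<le> 1"
  unfolding gauge_ball_def modular_bounded_def by blast

lemma gauge_ballI:
  "t > 0 \<Longrightarrow> (\<And>F. finite F \<Longrightarrow> (\<Sum>i\<in>F. \<bar>a i / t\<bar> powr p i) \<le> 1) \<Longrightarrow> gauge_ball t a"
  unfolding gauge_ball_def modular_bounded_def by blast

lemma gauge_ball_solid:
  assumes "gauge_ball t v" "\<And>i. \<bar>u i\<bar> \<le> \<bar>v i\<bar>"
  shows "gauge_ball t u"
proof (rule gauge_ballI)
  show t: "t > 0" using assms by (simp add: gauge_ball_def)
  fix F :: "nat set" assume "finite F"
  have "(\<Sum>i\<in>F. \<bar>u i / t\<bar> powr p i) \<le> (\<Sum>i\<in>F. \<bar>v i / t\<bar> powr p i)"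
    using t assms(2) p_ge_1 order_trans[OF zero_le_one p_ge_1]
    by (intro sum_mono powr_mono2) (auto simp: divide_right_mono)
  then show "(\<Sum>i\<in>F. \<bar>u i / t\<bar> powr p i) \<le> 1"
    using gauge_ballD[OF assms(1) \<open>finite F\<close>] by linarith
qed

lemma gauge_ball_scale:
  assumes "gauge_ball t a" "c \<noteq> 0"
  shows "gauge_ball (\<bar>c\<bar> * t) (c *\<^sub>R a)"
proof (rule gauge_ballI)
  show "\<bar>c\<bar> * t > 0" using assms by (simp add: gauge_ball_def)
  fix F :: "nat set" assume "finite F"
  have "\<bar>(c *\<^sub>R a) i / (\<bar>c\<bar> * t)\<bar> = \<bar>a i / t\<bar>" for i
    using assms(2) by (simp add: abs_mult)
  then show "(\<Sum>i\<in>F. \<bar>(c *\<^sub>R a) i / (\<bar>c\<bar> * t)\<bar> powr p i) \<le> 1"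
    using gauge_ballD[OF assms(1) \<open>finite F\<close>] by simp
qed

lemma gauge_ball_add:
  assumes u: "gauge_ball s u" and v: "gauge_ball t v"
  shows "gauge_ball (s + t) (u + v)"
proof (rule gauge_ballI)
  have s: "s > 0" and t: "t > 0" using assms by (auto simp: gauge_ball_def)
  then show "s + t > 0" by simp
  define l where "l = s / (s + t)"
  have l: "0 \<le> l" "l \<le> 1" "1 - l = t / (s + t)" using s t by (auto simp: l_def field_simps)
  fix F :: "nat set" assume F: "finite F"
  have "\<bar>(u + v) i / (s + t)\<bar> powr p i \<le> l * \<bar>u i / s\<bar> powr p i + (1 - l) * \<bar>v i / t\<bar> powr p i" for i
  proof -
    have "(u + v) i / (s + t) = l * (u i / s) + (1 - l) * (v i / t)"
      unfolding l(3) using s t by (simp add: l_def add_divide_distrib)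
    then have "\<bar>(u + v) i / (s + t)\<bar> \<le> l * \<bar>u i / s\<bar> + (1 - l) * \<bar>v i / t\<bar>"
      using l(1,2) abs_triangle_ineq[of "l * (u i / s)" "(1 - l) * (v i / t)"]
      by (simp only: abs_mult abs_of_nonneg[of l] abs_of_nonneg[of "1 - l"] diff_ge_0_iff_ge)
    then have "\<bar>(u + v) i / (s + t)\<bar> powr p i \<le> (l * \<bar>u i / s\<bar> + (1 - l) * \<bar>v i / t\<bar>) powr p i"
      using p_ge_1[of i] by (intro powr_mono2) auto
    also have "\<dots> \<le> l * \<bar>u i / s\<bar> powr p i + (1 - l) * \<bar>v i / t\<bar> powr p i"
      using l p_ge_1 by (intro powr_convex_combination) auto
    finally show ?thesis .
  qed
  then have "(\<Sum>i\<in>F. \<bar>(u + v) i / (s + t)\<bar> powr p i)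
      \<le> (\<Sum>i\<in>F. l * \<bar>u i / s\<bar> powr p i + (1 - l) * \<bar>v i / t\<bar> powr p i)"
    by (rule sum_mono)
  also have "\<dots> = l * (\<Sum>i\<in>F. \<bar>u i / s\<bar> powr p i) + (1 - l) * (\<Sum>i\<in>F. \<bar>v i / t\<bar> powr p i)"
    by (simp add: sum.distrib sum_distrib_left)
  also have "\<dots> \<le> l * 1 + (1 - l) * 1"
    using gauge_ballD[OF u F] gauge_ballD[OF v F] l by (intro add_mono mult_left_mono) auto
  finally show "(\<Sum>i\<in>F. \<bar>(u + v) i / (s + t)\<bar> powr p i) \<le> 1" by simp
qed

lemma gauge_ball_mono:
  assumes "gauge_ball s a" "s \<le> t"
  shows "gauge_ball t a"
proof (rule gauge_ballI)
  show t: "t > 0" using assms by (simp add: gauge_ball_def)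
  fix F :: "nat set" assume F: "finite F"
  have s: "s > 0" using assms by (simp add: gauge_ball_def)
  have "(\<Sum>i\<in>F. \<bar>a i / t\<bar> powr p i) \<le> (\<Sum>i\<in>F. \<bar>a i / s\<bar> powr p i)"
    using s assms(2) order_trans[OF zero_le_one p_ge_1]
    by (intro sum_mono powr_mono2) (auto intro!: divide_left_mono)
  then show "(\<Sum>i\<in>F. \<bar>a i / t\<bar> powr p i) \<le> 1"
    using gauge_ballD[OF assms(1) F] by linarith
qed

lemma gauge_ball_coordinate:
  assumes "gauge_ball t a"
  shows "\<bar>a i\<bar> \<le> t"
proof (rule ccontr)
  have t: "t > 0" using assms by (simp add: gauge_ball_def)
  assume "\<not> ?thesis"
  then have "\<bar>a i / t\<bar> > 1" using t by (simp add: field_simps)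
  then have "\<bar>a i / t\<bar> powr p i > 1" using p_ge_1[of i] by (intro gr_one_powr) auto
  moreover have "\<bar>a i / t\<bar> powr p i \<le> 1" using gauge_ballD[OF assms, of "{i}"] by simp
  ultimately show False by simp
qed

text \<open>A finite modular can be brought below one by scaling, because the modular is convex and vanishes
  at zero.\<close>

lemma nakano_l_iff: "a \<in> nakano_l p \<longleftrightarrow> (\<exists>t. gauge_ball t a)"
proof
  assume "\<exists>t. gauge_ball t a"
  then obtain t where t: "t > 0" "modular_bounded p 1 (\<lambda>i. a i / t)"
    by (auto simp: gauge_ball_def)
  then have "nakano_modular p (\<lambda>i. a i / t) \<le> ennreal 1"
    using nakano_modular_le_iff[of 1] by simp
  then have "nakano_modular p (\<lambda>i. a i / t) < \<infinity>"
    by (rule order.strict_trans1) simp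
  then show "a \<in> nakano_l p" using t(1) by (auto simp: nakano_l_def)
next
  assume "a \<in> nakano_l p"
  then obtain t where t: "t > 0" "nakano_modular p (\<lambda>i. a i / t) < \<infinity>"
    by (auto simp: nakano_l_def)
  define L where "L = max 1 (enn2real (nakano_modular p (\<lambda>i. a i / t)))"
  have "nakano_modular p (\<lambda>i. a i / t) = ennreal (enn2real (nakano_modular p (\<lambda>i. a i / t)))"
    using t(2) by (simp add: less_top)
  also have "\<dots> \<le> ennreal L" unfolding L_def by (intro ennreal_leI) simp
  finally have bd: "modular_bounded p L (\<lambda>i. a i / t)"
    using nakano_modular_le_iff[of L] by (simp add: L_def)
  have L: "L \<ge> 1" by (simp add: L_def)
  have "gauge_ball (L * t) a"
  proof (rule gauge_ballI)
    show "L * t > 0" using L t by simp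
    fix F :: "nat set" assume F: "finite F"
    have "\<bar>a i / (L * t)\<bar> powr p i \<le> (1 / L) * \<bar>a i / t\<bar> powr p i" for i
      using powr_contract[of "1 / L" 1 "p i" "a i / t"] L p_ge_1 by simp
    then have "(\<Sum>i\<in>F. \<bar>a i / (L * t)\<bar> powr p i) \<le> (1 / L) * (\<Sum>i\<in>F. \<bar>a i / t\<bar> powr p i)"
      unfolding sum_distrib_left by (intro sum_mono)
    also have "\<dots> \<le> (1 / L) * L"
      using bd F L by (intro mult_left_mono) (auto simp: modular_bounded_def)
    finally show "(\<Sum>i\<in>F. \<bar>a i / (L * t)\<bar> powr p i) \<le> 1" using L by simp
  qed
  then show "\<exists>t. gauge_ball t a" ..
qed

lemma gauge_ball_in_l: "gauge_ball t a \<Longrightarrow> a \<in> nakano_l p"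
  using nakano_l_iff by blast

lemma nakano_norm_le: "gauge_ball t a \<Longrightarrow> NN a \<le> t"
  unfolding nakano_norm_eq
  by (intro cInf_lower bdd_belowI[of _ 0]) (auto simp: gauge_ball_def)

lemma gauge_ball_of_norm_less:
  assumes "a \<in> nakano_l p" "NN a < t"
  shows "gauge_ball t a"
proof -
  have "{t. gauge_ball t a} \<noteq> {}" using assms(1) nakano_l_iff by auto
  from cInf_lessD[OF this assms(2)[unfolded nakano_norm_eq]]
  obtain s where "gauge_ball s a" "s < t" by blast
  then show ?thesis using gauge_ball_mono by auto
qed

lemma nakano_norm_ge_0: "a \<in> nakano_l p \<Longrightarrow> 0 \<le> NN a"
  unfolding nakano_norm_eq using nakano_l_iff
  by (intro cInf_greatest) (auto simp: gauge_ball_def)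

lemma nakano_norm_leI:
  assumes "a \<in> nakano_l p" "\<And>t. t > s \<Longrightarrow> gauge_ball t a"
  shows "NN a \<le> s"
  by (rule dense_ge) (rule nakano_norm_le, erule assms(2))

lemma coordinate_le_norm: "a \<in> nakano_l p \<Longrightarrow> \<bar>a i\<bar> \<le> NN a"
  by (rule dense_ge) (rule gauge_ball_coordinate, rule gauge_ball_of_norm_less)

lemma nakano_l_solid:
  assumes "v \<in> nakano_l p" "\<And>i. \<bar>u i\<bar> \<le> \<bar>v i\<bar>"
  shows "u \<in> nakano_l p" "NN u \<le> NN v"
proof -
  show u: "u \<in> nakano_l p" using assms gauge_ball_solid by (metis nakano_l_iff)
  show "NN u \<le> NN v"
    by (rule nakano_norm_leI[OF u])
      (rule gauge_ball_solid[OF gauge_ball_of_norm_less[OF assms(1)] assms(2)])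
qed

lemma gauge_ball_0: "t > 0 \<Longrightarrow> gauge_ball t 0"
  by (rule gauge_ballI) auto

sublocale nakano: normed_subspace "nakano_norm p" "nakano_l p"
proof
  show "subspace (nakano_l p)"
  proof (rule subspaceI)
    show "0 \<in> nakano_l p" using gauge_ball_0[of 1] gauge_ball_in_l by simp
    show "u + v \<in> nakano_l p" if "u \<in> nakano_l p" "v \<in> nakano_l p" for u v
      using that gauge_ball_add by (metis nakano_l_iff)
    show "c *\<^sub>R u \<in> nakano_l p" if "u \<in> nakano_l p" for c u
    proof (cases "c = 0")
      case True
      then show ?thesis using gauge_ball_0[of 1] gauge_ball_in_l by simp
    next
      case False
      then show ?thesis using that gauge_ball_scale by (metis nakano_l_iff)
    qed
  qed
next
  fix u v assume uv: "u \<in> nakano_l p" "v \<in> nakano_l p"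
  then have l: "u + v \<in> nakano_l p" using gauge_ball_add by (metis nakano_l_iff)
  show "NN (u + v) \<le> NN u + NN v"
  proof (rule nakano_norm_leI[OF l])
    fix t assume t: "NN u + NN v < t"
    define d where "d = (t - (NN u + NN v)) / 2"
    have d: "NN u + d + (NN v + d) = t" "d > 0" using t by (auto simp: d_def)
    show "gauge_ball t (u + v)"
      unfolding d(1)[symmetric] using d(2) uv by (intro gauge_ball_add gauge_ball_of_norm_less) auto
  qed
next
  have le: "NN (c *\<^sub>R u) \<le> \<bar>c\<bar> * NN u" if "u \<in> nakano_l p" "c \<noteq> 0" for c u
  proof -
    have "NN (c *\<^sub>R u) / \<bar>c\<bar> \<le> NN u"
    proof (rule dense_ge)
      fix t assume "NN u < t"
      then have "NN (c *\<^sub>R u) \<le> \<bar>c\<bar> * t"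
        using that by (intro nakano_norm_le gauge_ball_scale gauge_ball_of_norm_less) auto
      then show "NN (c *\<^sub>R u) / \<bar>c\<bar> \<le> t" using that(2) by (simp add: field_simps)
    qed
    then show ?thesis using that(2) by (simp add: field_simps)
  qed
  fix c u assume u: "u \<in> nakano_l p"
  show "NN (c *\<^sub>R u) = \<bar>c\<bar> * NN u"
  proof (cases "c = 0")
    case True
    have "NN 0 \<le> 0" by (rule dense_ge) (rule nakano_norm_le, erule gauge_ball_0)
    moreover have "0 \<le> NN 0" using gauge_ball_0[of 1] gauge_ball_in_l nakano_norm_ge_0 by simp
    ultimately show ?thesis using True by simp
  next
    case False
    have "c *\<^sub>R u \<in> nakano_l p" using u False gauge_ball_scale by (metis nakano_l_iff)
    from le[OF this, of "1 / c"] False have "NN u \<le> NN (c *\<^sub>R u) / \<bar>c\<bar>" by simp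
    with False have "\<bar>c\<bar> * NN u \<le> NN (c *\<^sub>R u)" by (simp add: field_simps)
    then show ?thesis using le[OF u False] by linarith
  qed
next
  fix u assume "u \<in> nakano_l p" "NN u = 0"
  then show "u = 0" using coordinate_le_norm by (intro ext) fastforce
qed

lemma restrict_seq_in_l: "a \<in> nakano_l p \<Longrightarrow> restrict_seq A a \<in> nakano_l p"
  by (rule nakano_l_solid(1)) (auto simp: restrict_seq_def)

lemma gauge_ball_unit_vector: "gauge_ball 1 (unit_vector n)"
proof (rule gauge_ballI)
  fix F :: "nat set" assume F: "finite F"
  have "(\<Sum>i\<in>F. \<bar>unit_vector n i / 1\<bar> powr p i) = (\<Sum>i\<in>F. if i = n then 1 else 0)"
    by (intro sum.cong) (auto simp: unit_vector_def)
  also have "\<dots> \<le> 1" using F by (simp add: sum.delta')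
  finally show "(\<Sum>i\<in>F. \<bar>unit_vector n i / 1\<bar> powr p i) \<le> 1" .
qed simp

lemma unit_vector_in_l: "unit_vector n \<in> nakano_l p"
  and norm_unit_vector_le: "NN (unit_vector n) \<le> 1"
  using gauge_ball_unit_vector gauge_ball_in_l nakano_norm_le by blast+

lemma nakano_h_eq: "nakano_h p = norm_closure NN (nakano_l p) (span (range unit_vector))"
  by (simp add: nakano_h_def closed_span_def)

lemma span_unit_vectors_subset_l: "span (range unit_vector) \<subseteq> nakano_l p"
  using unit_vector_in_l by (intro span_minimal nakano.carrier_subspace) auto

lemma subspace_nakano_h: "subspace (nakano_h p)"
  unfolding nakano_h_eq by (intro nakano.subspace_norm_closure subspace_span span_unit_vectors_subset_l)

lemma nakano_h_subset_l: "nakano_h p \<subseteq> nakano_l p"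
  unfolding nakano_h_eq by (rule nakano.norm_closure_subset)

lemma unit_vector_in_h: "unit_vector n \<in> nakano_h p"
  unfolding nakano_h_eq
  by (rule subsetD[OF nakano.subset_norm_closure[OF span_unit_vectors_subset_l]]) (simp add: span_base)

lemma span_unit_vectors_finite_support:
  assumes "u \<in> span (range unit_vector)"
  shows "\<exists>n0. \<forall>i\<ge>n0. u i = 0"
  using assms
proof (induction rule: span_induct_alt)
  case base
  then show ?case by simp
next
  case (step c x y)
  then obtain n n0 where "x = unit_vector n" "\<forall>i\<ge>n0. y i = 0" by auto
  then show ?case by (intro exI[of _ "max n0 (Suc n)"]) (auto simp: unit_vector_def)
qed

text \<open>Truncating to the left of the support of an approximant \<open>u\<close> leaves a part of \<open>v - u\<close>.\<close>

lemma nakano_h_tail_small: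
  assumes v: "v \<in> nakano_h p" and "\<epsilon> > 0"
  shows "\<exists>n0. \<forall>n\<ge>n0. NN (restrict_seq {n..} v) < \<epsilon>"
proof -
  obtain u where u: "u \<in> span (range unit_vector)" "NN (v - u) < \<epsilon>"
    by (rule norm_closureE[OF v[unfolded nakano_h_eq] \<open>\<epsilon> > 0\<close>])
  obtain n0 where n0: "\<forall>i\<ge>n0. u i = 0" using span_unit_vectors_finite_support[OF u(1)] by blast
  have l: "v - u \<in> nakano_l p"
    using u v nakano_h_subset_l span_unit_vectors_subset_l by (intro nakano.carrier_diff) auto
  have "NN (restrict_seq {n..} v) \<le> NN (v - u)" if "n \<ge> n0" for n
    using n0 that by (intro nakano_l_solid(2)[OF l]) (auto simp: restrict_seq_def)
  then show ?thesis using u(2) by (intro exI[of _ n0]) force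
qed

end

section \<open>Greedy basic sequences with exponents tending to infinity\<close>

locale nakano_space_inf = nakano_space +
  assumes p_tends_to_inf: "filterlim p at_top sequentially"
begin

text \<open>Boundedness makes the initial segments of length \<open>n\<close> range over a compact set; concretely, rounding
  the coordinates to multiples of \<open>\<eta>\<close> leaves finitely many values, so two rounded segments agree.\<close>

lemma close_heads:
  fixes x :: "nat \<Rightarrow> nat \<Rightarrow> real"
  assumes bd: "\<And>n k. \<bar>x n k\<bar> \<le> M" and \<eta>: "\<eta> > 0" and A: "finite A"
  obtains l m where "l \<notin> A" "m \<notin> A" "l \<noteq> m" "\<And>k. k < n \<Longrightarrow> \<bar>x l k - x m k\<bar> \<le> \<eta>"
proof -
  define f where "f = (\<lambda>l. map (\<lambda>k. \<lfloor>x l k / \<eta>\<rfloor>) [0..<n])"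
  define K where "K = \<lceil>M / \<eta>\<rceil> + 1"
  have "set (f l) \<subseteq> {-K..K}" for l
  proof -
    have "- K \<le> \<lfloor>x l k / \<eta>\<rfloor> \<and> \<lfloor>x l k / \<eta>\<rfloor> \<le> K" for k
    proof -
      have "\<bar>x l k / \<eta>\<bar> \<le> M / \<eta>" using bd[of l k] \<eta> by (simp add: divide_right_mono)
      then have "- (M / \<eta>) \<le> x l k / \<eta>" "x l k / \<eta> \<le> M / \<eta>" by (simp_all only: abs_le_iff) linarith+
      then show ?thesis unfolding K_def by linarith
    qed
    then show ?thesis by (auto simp: f_def)
  qed
  moreover have "length (f l) = n" for l by (simp add: f_def)
  ultimately have "f ` (UNIV - A) \<subseteq> {xs. set xs \<subseteq> {-K..K} \<and> length xs = n}"
    by blast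
  moreover have "finite {xs. set xs \<subseteq> {-K..K} \<and> length xs = n}"
    by (rule finite_lists_length_eq) simp
  ultimately have "finite (f ` (UNIV - A))" by (rule finite_subset)
  moreover have "infinite (UNIV - A)" using A by simp
  ultimately obtain l where l: "l \<in> UNIV - A" "infinite {m \<in> UNIV - A. f m = f l}"
    using pigeonhole_infinite[of "UNIV - A" f] by blast
  have "\<not> {m \<in> UNIV - A. f m = f l} \<subseteq> {l}"
    using l(2) finite_subset by blast
  then obtain m where m: "m \<notin> A" "f m = f l" "m \<noteq> l" by blast
  have "\<bar>x l k - x m k\<bar> \<le> \<eta>" if "k < n" for k
  proof -
    have "\<lfloor>x m k / \<eta>\<rfloor> = \<lfloor>x l k / \<eta>\<rfloor>"
      using m(2) that unfolding f_def by (simp add: list_eq_iff_nth_eq)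
    then have "\<bar>x l k / \<eta> - x m k / \<eta>\<bar> \<le> 1" by linarith
    then have "\<bar>x l k - x m k\<bar> / \<eta> \<le> 1" using \<eta> by (simp flip: diff_divide_distrib)
    then show ?thesis using \<eta> by simp
  qed
  then show ?thesis using that l m by blast
qed

lemma norm_restrict_head_le:
  assumes "\<And>k. k < n \<Longrightarrow> \<bar>d k\<bar> \<le> \<eta>"
  shows "NN (restrict_seq {..<n} d) \<le> real n * \<eta>"
proof -
  have "NN (restrict_seq {..<n} d) \<le> (\<Sum>k<n. NN (d k *\<^sub>R unit_vector k))"
    unfolding restrict_seq_eq_sum[OF finite_lessThan]
    by (intro nakano.norm_sum_le nakano.carrier_scale unit_vector_in_l)
  also have "\<dots> \<le> (\<Sum>k<n. \<eta>)"
  proof (rule sum_mono)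
    fix k assume "k \<in> {..<n}"
    then have "\<bar>d k\<bar> * NN (unit_vector k) \<le> \<eta> * 1"
      using assms norm_unit_vector_le nakano_norm_ge_0[OF unit_vector_in_l]
      by (intro mult_mono) (auto intro: order_trans[OF abs_ge_zero])
    then show "NN (d k *\<^sub>R unit_vector k) \<le> \<eta>"
      using nakano.norm_scale[OF unit_vector_in_l] by simp
  qed
  finally show ?thesis by simp
qed

text \<open>The block has modular at most one when divided by \<open>t\<close>. Dividing it by \<open>2 * t\<close> instead multiplies
  every term by at most \<open>1 / 2 ^ q\<close>, since the exponents on the block are at least \<open>q\<close>. As the supports
  are disjoint, the modulars add up.\<close>

lemma modular_add_block:
  assumes b: "modular_bounded p c b" "\<And>k. k \<ge> n \<Longrightarrow> b k = 0"
    and d: "gauge_ball t d" and q: "\<And>k. k \<ge> n \<Longrightarrow> real q \<le> p k"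
    and A: "A \<subseteq> {n..}"
  shows "modular_bounded p (c + 1 / 2 ^ q) (\<lambda>k. b k + restrict_seq A d k / (2 * t))"
  unfolding modular_bounded_def
proof (intro allI impI)
  fix F :: "nat set" assume F: "finite F"
  have t: "t > 0" using d by (simp add: gauge_ball_def)
  have "\<bar>b k + restrict_seq A d k / (2 * t)\<bar> powr p k \<le> \<bar>b k\<bar> powr p k + (1 / 2 ^ q) * \<bar>d k / t\<bar> powr p k" for k
  proof (cases "k \<in> A")
    case True
    then have k: "b k = 0" "real q \<le> p k" using A b(2) q by auto
    have "\<bar>(1 / 2) * (d k / t)\<bar> powr p k \<le> (1 / 2) powr real q * \<bar>d k / t\<bar> powr p k"
      using k(2) by (intro powr_contract) auto
    then show ?thesis using True k(1) by (simp add: restrict_seq_def powr_realpow power_divide mult.commute)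
  qed (auto simp: restrict_seq_def)
  then have "(\<Sum>k\<in>F. \<bar>b k + restrict_seq A d k / (2 * t)\<bar> powr p k)
      \<le> (\<Sum>k\<in>F. \<bar>b k\<bar> powr p k + (1 / 2 ^ q) * \<bar>d k / t\<bar> powr p k)"
    by (rule sum_mono)
  also have "\<dots> = (\<Sum>k\<in>F. \<bar>b k\<bar> powr p k) + (1 / 2 ^ q) * (\<Sum>k\<in>F. \<bar>d k / t\<bar> powr p k)"
    by (simp only: sum.distrib sum_distrib_left)
  also have "\<dots> \<le> c + (1 / 2 ^ q) * 1"
    using b(1) F gauge_ballD[OF d F] by (intro add_mono mult_left_mono) (auto simp: modular_bounded_def)
  finally show "(\<Sum>k\<in>F. \<bar>b k + restrict_seq A d k / (2 * t)\<bar> powr p k) \<le> c + 1 / 2 ^ q" by simp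
qed

text \<open>The sum of \<open>i\<close> differences \<open>x l - x m\<close> is a finitely supported part \<open>b\<close>, whose modular is
  controlled, plus a small error \<open>e\<close>. Each induction step takes two vectors that nearly agree where
  \<open>b\<close> lives and where the exponents are below \<open>i + 1\<close>. The head and the tail of their difference go
  into the error, and its middle part is a new block. The increments \<open>1 / 2 ^ i\<close> keep both budgets
  below one.\<close>

lemma sparse_differences:
  fixes x :: "nat \<Rightarrow> nat \<Rightarrow> real"
  assumes xh: "\<And>n. x n \<in> nakano_h p" and xM: "\<And>n. NN (x n) < M" and A: "finite A"
  shows "\<exists>B \<epsilon> b e n. finite B \<and> A \<inter> B = {} \<and> card B = 2 * i \<and> (\<forall>n. \<bar>\<epsilon> n\<bar> = 1) \<and>
     (\<Sum>n\<in>B. \<epsilon> n *\<^sub>R x n) = b + e \<and> (\<forall>k\<ge>n. b k = 0) \<and>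
     modular_bounded p (1 - 1 / 2 ^ i) (\<lambda>k. b k / (4 * M)) \<and>
     e \<in> nakano_l p \<and> NN e \<le> (1 - 1 / 2 ^ i) * M"
proof (induction i)
  case 0
  show ?case
    by (rule exI[of _ "{}"], rule exI[of _ "\<lambda>_. 1"], rule exI[of _ 0], rule exI[of _ 0], rule exI[of _ 0])
      (simp add: modular_bounded_def nakano.carrier_0[unfolded zero_fun_def]
        nakano.norm_0[unfolded zero_fun_def])
next
  case (Suc i)
  then obtain B \<epsilon> b e n0 where IH: "finite B" "A \<inter> B = {}" "card B = 2 * i" "\<forall>n. \<bar>\<epsilon> n\<bar> = 1"
    "(\<Sum>n\<in>B. \<epsilon> n *\<^sub>R x n) = b + e" "\<forall>k\<ge>n0. b k = 0"
    "modular_bounded p (1 - 1 / 2 ^ i) (\<lambda>k. b k / (4 * M))"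
    "e \<in> nakano_l p" "NN e \<le> (1 - 1 / 2 ^ i) * M" by blast
  have xl: "x n \<in> nakano_l p" for n using xh nakano_h_subset_l by auto
  have M: "M > 0" using nakano_norm_ge_0[OF xl] xM by (rule order.strict_trans1)
  obtain n1 where n1: "\<forall>k\<ge>n1. real (Suc i) \<le> p k" "n1 \<ge> n0"
  proof -
    have "\<forall>\<^sub>F k in sequentially. real (Suc i) \<le> p k"
      using p_tends_to_inf by (simp add: filterlim_at_top)
    then obtain n where "\<forall>k\<ge>n. real (Suc i) \<le> p k" by (auto simp: eventually_sequentially)
    then show ?thesis by (intro that[of "max n n0"]) auto
  qed
  \<comment> \<open>Head and tail each get half of the error increment \<open>M / 2 ^ Suc i\<close>.\<close>
  define \<delta> where "\<delta> = M / 2 ^ (i + 2)"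
  have \<delta>: "\<delta> > 0" using M by (simp add: \<delta>_def)
  define \<eta> where "\<eta> = \<delta> / (real n1 + 1)"
  have \<eta>: "\<eta> > 0" "real n1 * \<eta> \<le> \<delta>" using \<delta> by (auto simp: \<eta>_def field_simps)
  have "\<bar>x n k\<bar> \<le> M" for n k using coordinate_le_norm[OF xl, of n k] xM[of n] by linarith
  moreover have "finite (A \<union> B)" using A IH(1) by simp
  ultimately obtain l m where lm: "l \<notin> A \<union> B" "m \<notin> A \<union> B" "l \<noteq> m"
      "\<And>k. k < n1 \<Longrightarrow> \<bar>x l k - x m k\<bar> \<le> \<eta>"
    using close_heads[of x M \<eta> "A \<union> B" n1] \<eta>(1) by metis
  define d where "d = x l - x m"
  have dh: "d \<in> nakano_h p" unfolding d_def using xh subspace_diff[OF subspace_nakano_h] by blast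
  then have dl: "d \<in> nakano_l p" using nakano_h_subset_l by auto
  \<comment> \<open>This gauge of a difference explains the divisor \<open>4 * M = 2 * (2 * M)\<close> in the modular of \<open>b\<close>.\<close>
  have "NN d < 2 * M"
    unfolding d_def using nakano.norm_triangle_diff[OF xl xl, of l m] xM[of l] xM[of m] by linarith
  then have dM: "gauge_ball (2 * M) d" by (rule gauge_ball_of_norm_less[OF dl])
  obtain n2 where n2: "n2 \<ge> n1" "NN (restrict_seq {n2..} d) < \<delta>"
    using nakano_h_tail_small[OF dh \<delta>] by (metis max.cobounded1 max.cobounded2)
  have head: "NN (restrict_seq {..<n1} d) \<le> \<delta>"
    using norm_restrict_head_le[of n1 d \<eta>] lm(4) \<eta>(2) by (auto simp: d_def)
  define w where "w = restrict_seq {n1..<n2} d"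
  define r where "r = restrict_seq {..<n1} d + restrict_seq {n2..} d"
  have dsplit: "d = w + r"
    using n2(1) by (auto simp: w_def r_def restrict_seq_def fun_eq_iff)
  have rl: "r \<in> nakano_l p"
    unfolding r_def by (intro nakano.carrier_add restrict_seq_in_l dl)
  have "NN r \<le> NN (restrict_seq {..<n1} d) + NN (restrict_seq {n2..} d)"
    unfolding r_def by (intro nakano.norm_triangle restrict_seq_in_l dl)
  then have r: "NN r \<le> 2 * \<delta>" using head n2(2) by linarith
  show ?case
  proof (rule exI[of _ "insert l (insert m B)"], rule exI[of _ "\<epsilon>(l := 1, m := -1)"],
      rule exI[of _ "b + w"], rule exI[of _ "e + r"], rule exI[of _ n2], intro conjI)
    show "finite (insert l (insert m B))" "A \<inter> insert l (insert m B) = {}"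
      using IH lm by auto
    show "card (insert l (insert m B)) = 2 * Suc i" using IH lm by simp
    show "\<forall>n. \<bar>(\<epsilon>(l := 1, m := -1)) n\<bar> = 1" using IH(4) by simp
    have "(\<Sum>n\<in>B. (\<epsilon>(l := 1, m := -1)) n *\<^sub>R x n) = (\<Sum>n\<in>B. \<epsilon> n *\<^sub>R x n)"
      using lm by (intro sum.cong) auto
    then have "(\<Sum>n\<in>insert l (insert m B). (\<epsilon>(l := 1, m := -1)) n *\<^sub>R x n) = d + (b + e)"
      using IH(1,5) lm by (simp add: d_def)
    then show "(\<Sum>n\<in>insert l (insert m B). (\<epsilon>(l := 1, m := -1)) n *\<^sub>R x n) = b + w + (e + r)"
      using dsplit by simp
    show "\<forall>k\<ge>n2. (b + w) k = 0"
      using IH(6) n1(2) n2(1) by (auto simp: w_def restrict_seq_def)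
    have "modular_bounded p (1 - 1 / 2 ^ i + 1 / 2 ^ Suc i)
        (\<lambda>k. b k / (4 * M) + restrict_seq {n1..<n2} d k / (2 * (2 * M)))"
      using IH(6) n1 by (intro modular_add_block[OF IH(7) _ dM, of n1]) auto
    moreover have "1 - 1 / 2 ^ i + 1 / 2 ^ Suc i = 1 - (1::real) / 2 ^ Suc i" by (simp add: field_simps)
    moreover have "b k / (4 * M) + restrict_seq {n1..<n2} d k / (2 * (2 * M)) = (b + w) k / (4 * M)" for k
      by (simp add: w_def add_divide_distrib)
    ultimately show "modular_bounded p (1 - 1 / 2 ^ Suc i) (\<lambda>k. (b + w) k / (4 * M))" by simp
    show "e + r \<in> nakano_l p" using IH(8) rl by (rule nakano.carrier_add)
    have "NN (e + r) \<le> NN e + NN r" by (rule nakano.norm_triangle[OF IH(8) rl])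
    also have "\<dots> \<le> (1 - 1 / 2 ^ i) * M + 2 * (M / 2 ^ (i + 2))"
      using IH(9) r by (simp add: \<delta>_def)
    also have "\<dots> = (1 - 1 / 2 ^ Suc i) * M" by (simp add: field_simps)
    finally show "NN (e + r) \<le> (1 - 1 / 2 ^ Suc i) * M" .
  qed
qed

lemma bounded_signed_sums_exist:
  fixes x :: "nat \<Rightarrow> nat \<Rightarrow> real"
  assumes xh: "\<And>n. x n \<in> nakano_h p" and xM: "\<And>n. NN (x n) < M" and A: "finite A"
  shows "\<exists>B \<epsilon>. finite B \<and> A \<inter> B = {} \<and> card A \<le> card B \<and> (\<forall>n. \<bar>\<epsilon> n\<bar> = 1) \<and>
    NN (\<Sum>n\<in>B. \<epsilon> n *\<^sub>R x n) \<le> 5 * M"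
proof -
  obtain B \<epsilon> b e n where B: "finite B" "A \<inter> B = {}" "card B = 2 * card A" "\<forall>n. \<bar>\<epsilon> n\<bar> = 1"
    "(\<Sum>n\<in>B. \<epsilon> n *\<^sub>R x n) = b + e" "\<forall>k\<ge>n. b k = 0"
    "modular_bounded p (1 - 1 / 2 ^ card A) (\<lambda>k. b k / (4 * M))"
    "e \<in> nakano_l p" "NN e \<le> (1 - 1 / 2 ^ card A) * M"
    using sparse_differences[of x M A "card A", OF xh xM A] by (elim exE conjE)
  have "x 0 \<in> nakano_l p" using xh nakano_h_subset_l by auto
  then have M: "M > 0" using nakano_norm_ge_0[of "x 0"] xM[of 0] by simp
  have le: "1 - 1 / 2 ^ card A \<le> (1::real)" by simp
  have b: "gauge_ball (4 * M) b"
  proof (rule gauge_ballI)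
    fix F :: "nat set" assume "finite F"
    then have "(\<Sum>k\<in>F. \<bar>b k / (4 * M)\<bar> powr p k) \<le> 1 - 1 / 2 ^ card A"
      using B(7) unfolding modular_bounded_def by blast
    then show "(\<Sum>k\<in>F. \<bar>b k / (4 * M)\<bar> powr p k) \<le> 1" using le by (rule order_trans)
  qed (use M in simp)
  have "NN (b + e) \<le> NN b + NN e" by (rule nakano.norm_triangle[OF gauge_ball_in_l[OF b] B(8)])
  moreover have "(1 - 1 / 2 ^ card A) * M \<le> 1 * M" using le M by (intro mult_right_mono) auto
  ultimately have "NN (b + e) \<le> 5 * M" using nakano_norm_le[OF b] B(9) by linarith
  then show ?thesis using B by (intro exI[of _ B] exI[of _ \<epsilon>]) simp
qed

text \<open>Equivalence with the unit vector basis of \<open>c\<^sub>0\<close>, stated for arbitrary finite index sets and with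
  one constant for both estimates.\<close>

definition c0_like :: "(nat \<Rightarrow> nat \<Rightarrow> real) \<Rightarrow> real \<Rightarrow> bool" where
  "c0_like x D \<longleftrightarrow> D \<ge> 1 \<and> (\<forall>F a. finite F \<longrightarrow>
     (\<forall>n\<in>F. \<bar>a n\<bar> \<le> D * NN (\<Sum>n\<in>F. a n *\<^sub>R x n)) \<and>
     (\<forall>t\<ge>0. (\<forall>n\<in>F. \<bar>a n\<bar> \<le> t) \<longrightarrow> NN (\<Sum>n\<in>F. a n *\<^sub>R x n) \<le> D * t))"

lemma c0_like_ge_1: "c0_like x D \<Longrightarrow> D \<ge> 1"
  by (simp add: c0_like_def)

lemma c0_like_coefficient:
  "c0_like x D \<Longrightarrow> finite F \<Longrightarrow> n \<in> F \<Longrightarrow> \<bar>a n\<bar> \<le> D * NN (\<Sum>n\<in>F. a n *\<^sub>R x n)"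
  unfolding c0_like_def by blast

lemma c0_like_norm:
  "c0_like x D \<Longrightarrow> finite F \<Longrightarrow> 0 \<le> t \<Longrightarrow> (\<And>n. n \<in> F \<Longrightarrow> \<bar>a n\<bar> \<le> t) \<Longrightarrow> NN (\<Sum>n\<in>F. a n *\<^sub>R x n) \<le> D * t"
  unfolding c0_like_def by blast

text \<open>The lower estimate is the boundedness of the coefficients. For the upper one, a signed sum over
  \<open>A\<close> is compared by democracy with one of the bounded signed sums away from \<open>A\<close>, and convexity
  passes from signs to coefficients in \<open>[-1, 1]\<close>.\<close>

lemma greedy_basis_c0_like:
  assumes Y: "subspace Y" "Y \<subseteq> nakano_h p" and x: "greedy_basis NN Y x"
  shows "\<exists>D. c0_like x D"
proof -
  have Yl: "Y \<subseteq> nakano_l p" using Y nakano_h_subset_l by auto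
  obtain C where C: "nakano.greedy_constant x C"
    using nakano.greedy_basis_has_greedy_constant[OF Y(1) Yl x] by blast
  then have C0: "C \<ge> 0" by (simp add: nakano.greedy_constant_def)
  have sn: "semi_normalized NN x" and xY: "range x \<subseteq> Y"
    using x by (auto simp: greedy_basis_def schauder_basis_def)
  have xh: "x n \<in> nakano_h p" for n using xY Y by auto
  have xr: "range x \<subseteq> nakano_l p" using xY Yl by auto
  then have xl: "x n \<in> nakano_l p" for n by auto
  obtain M' where "\<And>n. NN (x n) \<le> M'" using sn by (auto simp: semi_normalized_def)
  then have xM: "NN (x n) < M' + 1" for n by (rule order.strict_trans1) simp
  define M where "M = M' + 1"
  have xM: "NN (x n) < M" for n using xM by (simp add: M_def)
  have M: "M > 0" using nakano_norm_ge_0[OF xl] xM by (rule order.strict_trans1)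
  obtain D where D: "D \<ge> 0" "\<forall>F a. finite F \<longrightarrow> (\<forall>n\<in>F. \<bar>a n\<bar> \<le> D * NN (\<Sum>n\<in>F. a n *\<^sub>R x n))"
    using nakano.greedy_coefficients_bounded[OF xr sn C] by blast
  have signs: "NN (\<Sum>n\<in>A. \<epsilon> n *\<^sub>R x n) \<le> C * (5 * M)"
    if A: "finite A" and \<epsilon>: "\<And>n. \<bar>\<epsilon> n\<bar> = 1" for A \<epsilon>
  proof -
    obtain B \<delta> where B: "finite B" "A \<inter> B = {}" "card A \<le> card B" "\<forall>n. \<bar>\<delta> n\<bar> = 1"
      "NN (\<Sum>n\<in>B. \<delta> n *\<^sub>R x n) \<le> 5 * M"
      using bounded_signed_sums_exist[of x M A, OF xh xM A] by (elim exE conjE)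
    define a where "a = (\<lambda>n. if n \<in> A then \<epsilon> n else \<delta> n)"
    have "NN (\<Sum>n\<in>A. a n *\<^sub>R x n) \<le> C * NN (\<Sum>n\<in>B. a n *\<^sub>R x n)"
      using A B \<epsilon> by (intro nakano.greedy_democracy[OF C]) (auto simp: a_def)
    moreover have "(\<Sum>n\<in>A. a n *\<^sub>R x n) = (\<Sum>n\<in>A. \<epsilon> n *\<^sub>R x n)"
      by (intro sum.cong) (auto simp: a_def)
    moreover have "(\<Sum>n\<in>B. a n *\<^sub>R x n) = (\<Sum>n\<in>B. \<delta> n *\<^sub>R x n)"
      using B(2) by (intro sum.cong) (auto simp: a_def)
    moreover have "C * NN (\<Sum>n\<in>B. \<delta> n *\<^sub>R x n) \<le> C * (5 * M)"
      using B(5) C0 by (rule mult_left_mono)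
    ultimately show ?thesis by simp
  qed
  define K where "K = C * (5 * M)"
  have K: "K \<ge> 0" using C0 M by (simp add: K_def)
  have cube: "NN (\<Sum>n\<in>F. a n *\<^sub>R x n) \<le> K" if "finite F" "\<And>n. n \<in> F \<Longrightarrow> \<bar>a n\<bar> \<le> 1" for F a
    using nakano.signs_control_cube[of F 0 x K a, OF that(1) nakano.carrier_0 xl _ that(2)]
      signs[OF that(1)] by (simp add: K_def)
  have upper: "NN (\<Sum>n\<in>F. a n *\<^sub>R x n) \<le> K * t"
    if F: "finite F" and t: "t \<ge> 0" and a: "\<And>n. n \<in> F \<Longrightarrow> \<bar>a n\<bar> \<le> t" for F a t
  proof (cases "t = 0")
    case True
    then have "(\<Sum>n\<in>F. a n *\<^sub>R x n) = 0" using a by (intro sum.neutral) force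
    then show ?thesis using True nakano.norm_0 by simp
  next
    case False
    then have t: "t > 0" using t by simp
    have "(\<Sum>n\<in>F. a n *\<^sub>R x n) = t *\<^sub>R (\<Sum>n\<in>F. (a n / t) *\<^sub>R x n)"
      unfolding scaleR_sum_right scaleR_scaleR using t by simp
    then have "NN (\<Sum>n\<in>F. a n *\<^sub>R x n) = t * NN (\<Sum>n\<in>F. (a n / t) *\<^sub>R x n)"
      using nakano.norm_scale[OF nakano.combination_in_carrier[OF xr]] t by simp
    also have "\<dots> \<le> t * K"
      using t a F by (intro mult_left_mono cube) auto
    finally show ?thesis by (simp add: mult.commute)
  qed
  define E where "E = 1 + D + K"
  have E: "D \<le> E" "K \<le> E" "1 \<le> E" using D K by (auto simp: E_def)
  have "c0_like x E"
    unfolding c0_like_def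
  proof (intro conjI allI impI ballI)
    fix F :: "nat set" and a :: "nat \<Rightarrow> real" and n assume F: "finite F" "n \<in> F"
    have "D * NN (\<Sum>n\<in>F. a n *\<^sub>R x n) \<le> E * NN (\<Sum>n\<in>F. a n *\<^sub>R x n)"
      using E by (intro mult_right_mono nakano.norm_nonneg nakano.combination_in_carrier xr)
    with D(2)[rule_format, OF F] show "\<bar>a n\<bar> \<le> E * NN (\<Sum>n\<in>F. a n *\<^sub>R x n)"
      by (rule order_trans)
  next
    fix F :: "nat set" and a :: "nat \<Rightarrow> real" and t :: real assume F: "finite F" "0 \<le> t" "\<forall>n\<in>F. \<bar>a n\<bar> \<le> t"
    have "K * t \<le> E * t" using E F by (intro mult_right_mono)
    with upper[OF F(1,2) F(3)[rule_format]] show "NN (\<Sum>n\<in>F. a n *\<^sub>R x n) \<le> E * t"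
      by (rule order_trans)
  qed (use E in simp)
  then show ?thesis ..
qed

end

section \<open>The space of null sequences\<close>

lemma c0_bdd_above: "a \<in> c0_space \<Longrightarrow> bdd_above (range (\<lambda>n. \<bar>a n\<bar>))"
  using convergent_imp_bounded[of a 0] by (auto simp: c0_space_def bounded_iff bdd_above_def)

lemma abs_le_c0_norm: "a \<in> c0_space \<Longrightarrow> \<bar>a n\<bar> \<le> c0_norm a"
  unfolding c0_norm_def by (intro cSUP_upper c0_bdd_above) auto

lemma c0_norm_le: "(\<And>n. \<bar>a n\<bar> \<le> t) \<Longrightarrow> c0_norm a \<le> t"
  unfolding c0_norm_def by (intro cSUP_least) auto

lemma c0_spaceI_eventually_0: "(\<And>n. n \<ge> m \<Longrightarrow> a n = 0) \<Longrightarrow> a \<in> c0_space"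
  unfolding c0_space_def mem_Collect_eq
  by (rule tendsto_eventually) (use eventually_sequentially in blast)

lemma restrict_seq_in_c0: "finite A \<Longrightarrow> restrict_seq A a \<in> c0_space"
proof -
  assume "finite A"
  then obtain m where "A \<subseteq> {..<m}" by (metis finite_nat_iff_bounded)
  then show ?thesis by (intro c0_spaceI_eventually_0[of m]) (auto simp: restrict_seq_def)
qed

lemma unit_vector_in_c0: "unit_vector n \<in> c0_space"
  by (rule c0_spaceI_eventually_0[of "Suc n"]) (auto simp: unit_vector_def)

lemma c0_norm_unit_vector: "c0_norm (unit_vector n) = 1"
proof (rule antisym)
  show "c0_norm (unit_vector n) \<le> 1" by (rule c0_norm_le) (simp add: unit_vector_def)
  show "1 \<le> c0_norm (unit_vector n)"
    using abs_le_c0_norm[OF unit_vector_in_c0, of n n] by (simp add: unit_vector_def)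
qed

lemma subspace_c0: "subspace c0_space"
  by (rule subspaceI)
    (auto simp: c0_space_def zero_fun_def plus_fun_def scaleR_fun_def intro!: tendsto_eq_intros)

lemma c0_tail_norm:
  assumes "a \<in> c0_space"
  shows "(\<lambda>m. c0_norm (a - restrict_seq {..<m} a)) \<longlonglongrightarrow> 0"
proof (rule LIMSEQ_I)
  fix r :: real assume r: "r > 0"
  have "a \<longlonglongrightarrow> 0" using assms by (simp add: c0_space_def)
  then obtain K where K: "\<And>n. n \<ge> K \<Longrightarrow> \<bar>a n\<bar> < r / 2"
    using LIMSEQ_D[of a 0 "r / 2"] r by auto
  have "norm (c0_norm (a - restrict_seq {..<m} a) - 0) < r" if "m \<ge> K" for m
  proof -
    have "c0_norm (a - restrict_seq {..<m} a) \<le> r / 2"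
      using K that r by (intro c0_norm_le) (auto simp: restrict_seq_def less_imp_le)
    moreover have "0 \<le> c0_norm (a - restrict_seq {..<m} a)"
      using abs_le_c0_norm[OF subspace_diff[OF subspace_c0 assms restrict_seq_in_c0], of "{..<m}" a 0]
      by (intro order_trans[OF abs_ge_zero]) auto
    ultimately show ?thesis using r by simp
  qed
  then show "\<exists>no. \<forall>n\<ge>no. norm (c0_norm (a - restrict_seq {..<n} a) - 0) < r" by blast
qed

text \<open>The unit vector basis of \<open>c\<^sub>0\<close> is greedy with constant one: a competitor \<open>A \<noteq> \<Lambda>\<close> of the same
  size misses some \<open>k \<in> \<Lambda>\<close>, and \<open>\<bar>v k\<bar>\<close> is at least every entry off \<open>\<Lambda>\<close>.\<close>

lemma c0_norm_greedy:
  assumes v: "v \<in> c0_space" and \<Lambda>: "finite \<Lambda>" and A: "finite A" "card A = card \<Lambda>"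
    and greedy: "\<And>n m. n \<in> \<Lambda> \<Longrightarrow> m \<notin> \<Lambda> \<Longrightarrow> \<bar>v m\<bar> \<le> \<bar>v n\<bar>"
  shows "c0_norm (v - restrict_seq \<Lambda> v) \<le> c0_norm (v - restrict_seq A \<alpha>)"
proof (rule c0_norm_le)
  fix n
  let ?w = "v - restrict_seq A \<alpha>"
  have w: "\<bar>?w k\<bar> \<le> c0_norm ?w" for k
    by (intro abs_le_c0_norm subspace_diff[OF subspace_c0] v restrict_seq_in_c0 A)
  show "\<bar>(v - restrict_seq \<Lambda> v) n\<bar> \<le> c0_norm ?w"
  proof (cases "n \<in> \<Lambda>")
    case True
    then show ?thesis using order_trans[OF abs_ge_zero w] by (simp add: restrict_seq_def)
  next
    case False
    show ?thesis
    proof (cases "\<Lambda> \<subseteq> A")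
      case True
      then have "\<Lambda> = A" using A by (metis card_subset_eq)
      then show ?thesis using w[of n] False by (simp add: restrict_seq_def)
    next
      case notsub: False
      then obtain k where k: "k \<in> \<Lambda>" "k \<notin> A" by auto
      have "\<bar>v n\<bar> \<le> \<bar>v k\<bar>" by (rule greedy[OF k(1) False])
      then show ?thesis using w[of k] k(2) False by (simp add: restrict_seq_def)
    qed
  qed
qed

text \<open>The basis consists of the preimages of the unit vectors. The isomorphism turns residuals into
  residuals and expansion coefficients into entries, and it distorts norms by \<open>C\<close> in each direction.
  Hence the greedy constant one of the unit vectors becomes \<open>C * C\<close>.\<close>

lemma (in normed_subspace) isomorphic_c0_imp_greedy_basis:
  assumes Y: "subspace Y" "Y \<subseteq> X" and iso: "isomorphic_spaces N Y c0_norm c0_space"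
  shows "\<exists>x. greedy_basis N Y x"
proof -
  obtain T C where T: "bij_betw T Y c0_space"
    and T_add: "\<And>u v. u \<in> Y \<Longrightarrow> v \<in> Y \<Longrightarrow> T (u + v) = T u + T v"
    and T_scale: "\<And>r v. v \<in> Y \<Longrightarrow> T (r *\<^sub>R v) = r *\<^sub>R T v"
    and C: "C \<ge> 1" and T_lower: "\<And>v. v \<in> Y \<Longrightarrow> inverse C * N v \<le> c0_norm (T v)"
    and T_norm: "\<And>v. v \<in> Y \<Longrightarrow> c0_norm (T v) \<le> C * N v"
    using iso unfolding isomorphic_spaces_def by blast
  have N_le: "N v \<le> C * c0_norm (T v)" if "v \<in> Y" for v
    using T_lower[OF that] C by (simp add: field_simps)
  have Tc0: "T v \<in> c0_space" if "v \<in> Y" for v using T that by (auto simp: bij_betw_def)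
  define x where "x n = the_inv_into Y T (unit_vector n)" for n
  have xY: "x n \<in> Y" and Tx: "T (x n) = unit_vector n" for n
    using T unit_vector_in_c0[of n]
    by (auto simp: x_def bij_betw_def f_the_inv_into_f intro!: the_inv_into_into)
  have xr: "range x \<subseteq> Y" using xY by auto
  have combY: "(\<Sum>n\<in>F. a n *\<^sub>R x n) \<in> Y" for F a
    by (intro subspace_sum subspace_scale Y xY)
  have T0: "T 0 = 0" using T_scale[OF subspace_0[OF Y(1)], of 0] by simp
  have Tsum: "T (\<Sum>n\<in>F. a n *\<^sub>R x n) = restrict_seq F a" if "finite F" for F a
  proof -
    have "T (\<Sum>n\<in>F. a n *\<^sub>R x n) = (\<Sum>n\<in>F. a n *\<^sub>R unit_vector n)"
      using that
      by (induction F) (simp_all add: T0 T_add T_scale Tx combY xY subspace_scale[OF Y(1)])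
    then show ?thesis using restrict_seq_eq_sum[OF that] by simp
  qed
  have Tdiff: "T (v - (\<Sum>n\<in>F. a n *\<^sub>R x n)) = T v - restrict_seq F a" if "v \<in> Y" "finite F" for v F a
    using T_add[of v "- 1 *\<^sub>R (\<Sum>n\<in>F. a n *\<^sub>R x n)"] T_scale[OF combY[of a F], of "-1"] that
      Tsum[OF that(2), of a] combY[of a F] subspace_neg[OF Y(1) combY[of a F]] by simp
  have dY: "v - (\<Sum>n\<in>F. a n *\<^sub>R x n) \<in> Y" if "v \<in> Y" for v F a
    by (intro subspace_diff Y that combY)
  have up: "N (v - (\<Sum>n\<in>F. a n *\<^sub>R x n)) \<le> C * c0_norm (T v - restrict_seq F a)"
    if "v \<in> Y" "finite F" for v F a
    using N_le[OF dY[OF that(1), where F = F and a = a]] unfolding Tdiff[OF that] .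
  have low: "c0_norm (T v - restrict_seq F a) \<le> C * N (v - (\<Sum>n\<in>F. a n *\<^sub>R x n))"
    if "v \<in> Y" "finite F" for v F a
    using T_norm[OF dY[OF that(1), where F = F and a = a]] unfolding Tdiff[OF that] .
  have ex: "is_expansion N x v (T v)" if v: "v \<in> Y" for v
    unfolding is_expansion_def
  proof (rule tendsto_sandwich[OF _ _ tendsto_const])
    show "\<forall>\<^sub>F m in sequentially. 0 \<le> N (v - (\<Sum>n<m. T v n *\<^sub>R x n))"
      using dY[OF v] Y by (intro always_eventually allI norm_nonneg) auto
    show "\<forall>\<^sub>F m in sequentially. N (v - (\<Sum>n<m. T v n *\<^sub>R x n)) \<le> C * c0_norm (T v - restrict_seq {..<m} (T v))"
      using up[OF v] by (intro always_eventually allI) auto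
    show "(\<lambda>m. C * c0_norm (T v - restrict_seq {..<m} (T v))) \<longlonglongrightarrow> 0"
      using tendsto_mult_left[OF c0_tail_norm[OF Tc0[OF v]], of C] by simp
  qed
  have unique: "a = T v" if v: "v \<in> Y" and a: "is_expansion N x v a" for v a
  proof
    fix n
    have "\<bar>T v n - a n\<bar> \<le> C * N (v - (\<Sum>n<m. a n *\<^sub>R x n))" if "m \<ge> Suc n" for m
    proof -
      have "T v - restrict_seq {..<m} a \<in> c0_space"
        by (intro subspace_diff[OF subspace_c0] Tc0 v restrict_seq_in_c0) simp
      from abs_le_c0_norm[OF this, of n] have "\<bar>T v n - a n\<bar> \<le> c0_norm (T v - restrict_seq {..<m} a)"
        using that by (simp add: restrict_seq_def)
      also have "\<dots> \<le> C * N (v - (\<Sum>n<m. a n *\<^sub>R x n))" by (rule low[OF v]) simp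
      finally show ?thesis .
    qed
    moreover have "(\<lambda>m. C * N (v - (\<Sum>n<m. a n *\<^sub>R x n))) \<longlonglongrightarrow> C * 0"
      using a unfolding is_expansion_def by (rule tendsto_mult_left)
    ultimately have "\<bar>T v n - a n\<bar> \<le> C * 0"
      by (intro LIMSEQ_le_const) auto
    then show "a n = T v n" by simp
  qed
  have sb: "schauder_basis N Y x"
    unfolding schauder_basis_def using xr ex unique by (intro conjI ballI ex1I) auto
  have coeff: "coeff_functional N x n v = T v n" if "v \<in> Y" for n v
    by (rule coeff_functional_eq[OF sb that ex[OF that]])
  have "inverse C \<le> N (x n) \<and> N (x n) \<le> C" for n
    using N_le[OF xY, of n] T_norm[OF xY, of n] C
    by (simp add: Tx c0_norm_unit_vector field_simps)
  then have sn: "semi_normalized N x"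
    unfolding semi_normalized_def using C by (intro exI[of _ "inverse C"] conjI exI[of _ C]) auto
  have "N (v - (\<Sum>n\<in>\<Lambda>. coeff_functional N x n v *\<^sub>R x n)) \<le> (C * C) * best_approx_error N x k v"
    if v: "v \<in> Y" and \<Lambda>: "finite \<Lambda>" "card \<Lambda> = k"
      and greedy: "\<forall>n\<in>\<Lambda>. \<forall>m. m \<notin> \<Lambda> \<longrightarrow> \<bar>coeff_functional N x m v\<bar> \<le> \<bar>coeff_functional N x n v\<bar>" for v k \<Lambda>
  proof -
    let ?e = "N (v - (\<Sum>n\<in>\<Lambda>. T v n *\<^sub>R x n))"
    have "?e / (C * C) \<le> best_approx_error N x k v"
    proof (rule le_best_approx_error)
      fix A :: "nat set" and \<alpha> assume A: "finite A" "card A = k"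
      have "?e \<le> C * c0_norm (T v - restrict_seq \<Lambda> (T v))" by (rule up[OF v \<Lambda>(1)])
      also have "\<dots> \<le> C * c0_norm (T v - restrict_seq A \<alpha>)"
        using C A \<Lambda> greedy Tc0[OF v] coeff[OF v] by (intro mult_left_mono c0_norm_greedy) auto
      also have "\<dots> \<le> C * (C * N (v - (\<Sum>n\<in>A. \<alpha> n *\<^sub>R x n)))"
        using C low[OF v A(1)] by (intro mult_left_mono) auto
      finally show "?e / (C * C) \<le> N (v - (\<Sum>n\<in>A. \<alpha> n *\<^sub>R x n))"
        using C by (simp add: field_simps)
    qed
    then show ?thesis using C by (simp add: coeff[OF v] field_simps)
  qed
  then have "greedy_basis N Y x" unfolding greedy_basis_def using sb sn by blast
  then show ?thesis by (intro exI[of _ x])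
qed

section \<open>Completeness and isomorphism with the space of null sequences\<close>

context nakano_space
begin

text \<open>A Cauchy sequence converges coordinatewise. The inequalities for finite sums that define the
  gauge of \<open>u n - u m\<close> survive the limit \<open>n \<rightarrow> \<infinity>\<close> (Fatou's lemma for finite sums), which turns
  coordinatewise into norm convergence.\<close>

lemma nakano_h_complete:
  assumes u: "\<And>m. u m \<in> nakano_h p"
    and Cauchy: "\<And>\<epsilon>. \<epsilon> > 0 \<Longrightarrow> \<exists>K. \<forall>m\<ge>K. \<forall>n\<ge>K. NN (u m - u n) < \<epsilon>"
  obtains v where "v \<in> nakano_h p" "(\<lambda>m. NN (v - u m)) \<longlonglongrightarrow> 0"
proof -
  have ul: "u m \<in> nakano_l p" for m using u nakano_h_subset_l by auto
  have dl: "u m - u n \<in> nakano_l p" for m n by (intro nakano.carrier_diff ul)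
  have "Cauchy (\<lambda>m. u m k)" for k
  proof (rule CauchyI)
    fix e :: real assume "e > 0"
    then obtain K where "\<forall>m\<ge>K. \<forall>n\<ge>K. NN (u m - u n) < e" using Cauchy by blast
    moreover have "norm (u m k - u n k) \<le> NN (u m - u n)" for m n
      using coordinate_le_norm[OF dl, of m n k] by simp
    ultimately show "\<exists>M. \<forall>m\<ge>M. \<forall>n\<ge>M. norm (u m k - u n k) < e"
      by (intro exI[of _ K]) (meson order.strict_trans1)
  qed
  then have conv: "(\<lambda>m. u m k) \<longlonglongrightarrow> lim (\<lambda>m. u m k)" for k
    using Cauchy_convergent convergent_LIMSEQ_iff by blast
  define v where "v k = lim (\<lambda>m. u m k)" for k
  have conv: "(\<lambda>m. u m k) \<longlonglongrightarrow> v k" for k using conv by (simp add: v_def)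
  have ball: "gauge_ball \<epsilon> (v - u m)"
    if e: "\<epsilon> > 0" and K: "\<forall>m\<ge>K. \<forall>n\<ge>K. NN (u m - u n) < \<epsilon>" and m: "m \<ge> K" for \<epsilon> K m
  proof (rule gauge_ballI[OF e])
    fix F :: "nat set" assume F: "finite F"
    have "(\<lambda>n. \<Sum>k\<in>F. \<bar>(u n - u m) k / \<epsilon>\<bar> powr p k) \<longlonglongrightarrow> (\<Sum>k\<in>F. \<bar>(v - u m) k / \<epsilon>\<bar> powr p k)"
    proof (rule tendsto_sum)
      fix k assume "k \<in> F"
      have "(\<lambda>n. \<bar>(u n k - u m k) / \<epsilon>\<bar>) \<longlonglongrightarrow> \<bar>(v k - u m k) / \<epsilon>\<bar>"
        using e by (intro tendsto_intros conv) auto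
      moreover have "p k > 0" using p_ge_1[of k] by linarith
      ultimately show "(\<lambda>n. \<bar>(u n - u m) k / \<epsilon>\<bar> powr p k) \<longlonglongrightarrow> \<bar>(v - u m) k / \<epsilon>\<bar> powr p k"
        unfolding minus_apply by (intro tendsto_powr2 tendsto_const) auto
    qed
    moreover have "(\<Sum>k\<in>F. \<bar>(u n - u m) k / \<epsilon>\<bar> powr p k) \<le> 1" if "n \<ge> K" for n
      using K m that by (intro gauge_ballD[OF gauge_ball_of_norm_less[OF dl] F]) auto
    ultimately show "(\<Sum>k\<in>F. \<bar>(v - u m) k / \<epsilon>\<bar> powr p k) \<le> 1"
      by (intro LIMSEQ_le_const2) auto
  qed
  have vl: "v \<in> nakano_l p"
  proof -
    obtain K where "\<forall>m\<ge>K. \<forall>n\<ge>K. NN (u m - u n) < 1" using Cauchy[of 1] by auto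
    then have "v - u K \<in> nakano_l p" using ball[of 1 K K] gauge_ball_in_l by simp
    from nakano.carrier_add[OF this ul[of K]] show ?thesis by simp
  qed
  have small: "\<exists>K. \<forall>m\<ge>K. NN (v - u m) < \<epsilon>" if "\<epsilon> > 0" for \<epsilon>
  proof -
    have e: "\<epsilon> / 2 > 0" using that by simp
    then obtain K where K: "\<forall>m\<ge>K. \<forall>n\<ge>K. NN (u m - u n) < \<epsilon> / 2" using Cauchy by blast
    have "NN (v - u m) < \<epsilon>" if "m \<ge> K" for m
      using nakano_norm_le[OF ball[OF e K that]] \<open>\<epsilon> > 0\<close> by simp
    then show ?thesis by blast
  qed
  have "v \<in> norm_closure NN (nakano_l p) (nakano_h p)"
    unfolding norm_closure_def using vl small u by blast
  then have "v \<in> nakano_h p"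
    unfolding nakano_h_eq
    by (rule nakano.norm_closure_idem[OF span_unit_vectors_subset_l order.refl])
  moreover have "(\<lambda>m. NN (v - u m)) \<longlonglongrightarrow> 0"
  proof (rule LIMSEQ_I)
    fix r :: real assume "r > 0"
    moreover have "0 \<le> NN (v - u m)" for m
      by (intro nakano_norm_ge_0 nakano.carrier_diff vl ul)
    ultimately show "\<exists>no. \<forall>n\<ge>no. norm (NN (v - u n) - 0) < r" using small by simp
  qed
  ultimately show ?thesis by (rule that)
qed

end

context nakano_space_inf
begin

lemma c0_like_equivalent:
  assumes x: "c0_like x D"
  shows "equivalent_sequences NN x c0_norm unit_vector"
  unfolding equivalent_sequences_def
proof (intro exI[of _ D] conjI allI impI)
  show D: "D \<ge> 1" by (rule c0_like_ge_1[OF x])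
  fix a :: "nat \<Rightarrow> real" assume fin: "finite {n. a n \<noteq> 0}"
  let ?s = "\<Sum>n | a n \<noteq> 0. a n *\<^sub>R x n"
  have a: "(\<Sum>n | a n \<noteq> 0. a n *\<^sub>R unit_vector n) = a"
    unfolding restrict_seq_eq_sum[OF fin, symmetric] by (auto simp: restrict_seq_def)
  have ac0: "a \<in> c0_space" using restrict_seq_in_c0[OF fin, of a] restrict_seq_eq_sum[OF fin, of a] a by simp
  have "NN ?s \<le> D * c0_norm a"
    by (rule c0_like_norm[OF x fin order_trans[OF abs_ge_zero abs_le_c0_norm[OF ac0]] abs_le_c0_norm[OF ac0]])
  then show "inverse D * NN ?s \<le> c0_norm (\<Sum>n | a n \<noteq> 0. a n *\<^sub>R unit_vector n)"
    unfolding a using D by (simp add: field_simps)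
  have s0: "0 \<le> D * NN ?s"
  proof (cases "{n. a n \<noteq> 0} = {}")
    case True
    then show ?thesis by (simp add: nakano.norm_0)
  next
    case False
    then obtain n where "n \<in> {n. a n \<noteq> 0}" by blast
    from c0_like_coefficient[OF x fin this, of a] show ?thesis by (rule order_trans[OF abs_ge_zero])
  qed
  show "c0_norm (\<Sum>n | a n \<noteq> 0. a n *\<^sub>R unit_vector n) \<le> D * NN ?s"
    unfolding a
  proof (rule c0_norm_le)
    fix n
    show "\<bar>a n\<bar> \<le> D * NN ?s"
      using s0 c0_like_coefficient[OF x fin, of n a] by (cases "a n = 0") auto
  qed
qed

lemma c0_like_expansion_coefficient:
  assumes x: "c0_like x D" "range x \<subseteq> nakano_l p" and v: "v \<in> nakano_l p" "is_expansion NN x v a"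
  shows "\<bar>a n\<bar> \<le> D * NN v"
proof -
  have "(\<lambda>m. D * NN (\<Sum>n<m. a n *\<^sub>R x n)) \<longlonglongrightarrow> D * NN v"
    by (intro tendsto_mult_left nakano.expansion_norm_limit x v)
  moreover have "\<bar>a n\<bar> \<le> D * NN (\<Sum>n<m. a n *\<^sub>R x n)" if "m \<ge> Suc n" for m
    using that by (intro c0_like_coefficient[OF x(1)]) auto
  ultimately show ?thesis by (intro LIMSEQ_le_const) auto
qed

text \<open>The term \<open>a m *\<^sub>R x m\<close> is the difference of two consecutive remainders of the expansion, and its
  norm controls \<open>\<bar>a m\<bar>\<close>.\<close>

lemma c0_like_expansion_null:
  assumes x: "c0_like x D" "range x \<subseteq> nakano_l p" and v: "v \<in> nakano_l p" "is_expansion NN x v a"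
  shows "a \<in> c0_space"
proof -
  let ?r = "\<lambda>m. v - (\<Sum>n<m. a n *\<^sub>R x n)"
  have rl: "?r m \<in> nakano_l p" for m
    by (intro nakano.carrier_diff v nakano.combination_in_carrier x)
  have "\<bar>a m\<bar> \<le> D * (NN (?r m) + NN (?r (Suc m)))" for m
  proof -
    have "\<bar>a m\<bar> \<le> D * NN (a m *\<^sub>R x m)"
      using c0_like_coefficient[OF x(1), of "{m}" m a] by simp
    moreover have "a m *\<^sub>R x m = ?r m - ?r (Suc m)" by simp
    moreover have "NN (?r m - ?r (Suc m)) \<le> NN (?r m) + NN (?r (Suc m))"
      by (rule nakano.norm_triangle_diff[OF rl rl])
    ultimately show ?thesis
      using c0_like_ge_1[OF x(1)] by (smt (verit) mult_left_mono)
  qed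
  moreover have "(\<lambda>m. D * (NN (?r m) + NN (?r (Suc m)))) \<longlonglongrightarrow> D * (0 + 0)"
    using v(2) LIMSEQ_Suc[OF v(2)[unfolded is_expansion_def]] unfolding is_expansion_def
    by (intro tendsto_mult_left tendsto_add)
  ultimately have "a \<longlonglongrightarrow> 0"
    by (intro Lim_null_comparison[OF always_eventually, of a "\<lambda>m. D * (NN (?r m) + NN (?r (Suc m)))"]) auto
  then show ?thesis by (simp add: c0_space_def)
qed

lemma c0_like_norm_expansion:
  assumes x: "c0_like x D" "range x \<subseteq> nakano_l p" and v: "v \<in> nakano_l p" "is_expansion NN x v a"
  shows "NN v \<le> D * c0_norm a"
proof -
  have a: "a \<in> c0_space" by (rule c0_like_expansion_null[OF assms])
  have "NN (\<Sum>n<m. a n *\<^sub>R x n) \<le> D * c0_norm a" for m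
    by (rule c0_like_norm[OF x(1) finite_lessThan order_trans[OF abs_ge_zero abs_le_c0_norm[OF a]]
        abs_le_c0_norm[OF a]])
  then show ?thesis
    by (intro LIMSEQ_le_const2[OF nakano.expansion_norm_limit[OF x(2) v]]) auto
qed

text \<open>The upper estimate bounds blocks of the series by the largest coefficient in the block, so the
  partial sums are Cauchy.\<close>

lemma c0_like_series_converges:
  assumes x: "c0_like x D" "range x \<subseteq> nakano_h p" and a: "a \<in> c0_space"
  obtains v where "v \<in> nakano_h p" "is_expansion NN x v a"
proof -
  let ?s = "\<lambda>m. \<Sum>n<m. a n *\<^sub>R x n"
  have D: "D \<ge> 1" by (rule c0_like_ge_1[OF x(1)])
  have xl: "range x \<subseteq> nakano_l p" using x(2) nakano_h_subset_l by auto
  have sh: "?s m \<in> nakano_h p" for m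
    using x(2) by (intro subspace_sum subspace_scale subspace_nakano_h) auto
  have sl: "?s m \<in> nakano_l p" for m by (rule nakano.combination_in_carrier[OF xl])
  have "\<exists>K. \<forall>m\<ge>K. \<forall>n\<ge>K. NN (?s m - ?s n) < \<epsilon>"
    if e: "\<epsilon> > 0" for \<epsilon>
  proof -
    have "a \<longlonglongrightarrow> 0" using a by (simp add: c0_space_def)
    moreover have d: "\<epsilon> / (2 * D) > 0" using e D by simp
    ultimately obtain K where K: "\<And>n. n \<ge> K \<Longrightarrow> \<bar>a n\<bar> < \<epsilon> / (2 * D)"
      using LIMSEQ_D[of a 0 "\<epsilon> / (2 * D)"] by auto
    have le: "NN (?s m - ?s n) < \<epsilon>" if "n \<ge> K" "m \<ge> n" for m n
    proof -
      have "?s m - ?s n = (\<Sum>j\<in>{..<m} - {..<n}. a j *\<^sub>R x j)"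
        using that by (subst sum_diff) auto
      moreover have "NN (\<Sum>j\<in>{..<m} - {..<n}. a j *\<^sub>R x j) \<le> D * (\<epsilon> / (2 * D))"
        using K that d by (intro c0_like_norm[OF x(1)]) (auto intro!: less_imp_le)
      moreover have "D * (\<epsilon> / (2 * D)) < \<epsilon>" using D e by simp
      ultimately show ?thesis by simp
    qed
    have "NN (?s m - ?s n) < \<epsilon>" if "m \<ge> K" "n \<ge> K" for m n
    proof (cases "m \<ge> n")
      case True
      then show ?thesis using le that by simp
    next
      case False
      then show ?thesis using le[of m n] that nakano.norm_diff_commute[OF sl sl, of m n] by simp
    qed
    then show ?thesis by blast
  qed
  from nakano_h_complete[of ?s, OF sh this]
  obtain v where v: "v \<in> nakano_h p" "(\<lambda>m. NN (v - ?s m)) \<longlonglongrightarrow> 0" .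
  have "is_expansion NN x v a" unfolding is_expansion_def by (rule v(2))
  then show ?thesis by (rule that[OF v(1)])
qed

text \<open>The isomorphism sends a vector to its sequence of coefficients. It is onto because the series with
  coefficients in \<open>c\<^sub>0\<close> converge in \<open>h\<close> and \<open>Y\<close> is closed.\<close>

lemma greedy_basis_imp_isomorphic_c0:
  assumes Y: "closed_subspace NN (nakano_h p) Y" and x: "greedy_basis NN Y x"
  shows "isomorphic_spaces NN Y c0_norm c0_space"
proof -
  have sY: "subspace Y" "Y \<subseteq> nakano_h p" and cl: "norm_closure NN (nakano_h p) Y = Y"
    using Y by (auto simp: closed_subspace_def)
  then have Yl: "Y \<subseteq> nakano_l p" using nakano_h_subset_l by auto
  have sb: "schauder_basis NN Y x" using x by (simp add: greedy_basis_def)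
  then have xY: "range x \<subseteq> Y" by (simp add: schauder_basis_def)
  then have xh: "range x \<subseteq> nakano_h p" and xl: "range x \<subseteq> nakano_l p" using sY Yl by auto
  obtain D where D: "c0_like x D" using greedy_basis_c0_like[OF sY x] by (elim exE)
  define T where "T = (\<lambda>v. THE a. is_expansion NN x v a)"
  have unique: "\<exists>!a. is_expansion NN x v a" if "v \<in> Y" for v
    using sb that unfolding schauder_basis_def by blast
  have T: "is_expansion NN x v (T v)" if "v \<in> Y" for v
    unfolding T_def by (rule theI'[of "\<lambda>a. is_expansion NN x v a", OF unique[OF that]])
  have T_eq: "T v = a" if "v \<in> Y" "is_expansion NN x v a" for v a
    unfolding T_def by (rule the1_equality[of "\<lambda>a. is_expansion NN x v a", OF unique[OF that(1)] that(2)])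
  have "bij_betw T Y c0_space"
    unfolding bij_betw_def
  proof (intro conjI inj_onI equalityI subsetI)
    fix u v assume uv: "u \<in> Y" "v \<in> Y" "T u = T v"
    show "u = v"
    proof (rule nakano.expansion_determines_vector[OF xl])
      show "u \<in> nakano_l p" "v \<in> nakano_l p" using uv Yl by auto
      show "is_expansion NN x u (T u)" "is_expansion NN x v (T u)"
        using T[OF uv(1)] T[OF uv(2)] uv(3) by simp_all
    qed
  next
    fix a assume "a \<in> T ` Y"
    then obtain v where v: "v \<in> Y" "a = T v" by (elim imageE)
    have "v \<in> nakano_l p" using v(1) Yl by auto
    then show "a \<in> c0_space" unfolding v(2) by (rule c0_like_expansion_null[OF D xl _ T[OF v(1)]])
  next
    fix a assume "a \<in> c0_space"
    then obtain v where v: "v \<in> nakano_h p" "is_expansion NN x v a"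
      by (rule c0_like_series_converges[OF D xh])
    have "\<exists>u\<in>Y. NN (v - u) < \<epsilon>" if e: "\<epsilon> > 0" for \<epsilon>
    proof -
      obtain m where m: "norm (NN (v - (\<Sum>n<m. a n *\<^sub>R x n)) - 0) < \<epsilon>"
        using LIMSEQ_D[OF v(2)[unfolded is_expansion_def] e] by blast
      have "(\<Sum>n<m. a n *\<^sub>R x n) \<in> Y" using xY by (intro subspace_sum subspace_scale sY) auto
      with m show ?thesis by (intro bexI[of _ "\<Sum>n<m. a n *\<^sub>R x n"]) auto
    qed
    then have "v \<in> norm_closure NN (nakano_h p) Y" using v(1) by (auto simp: norm_closure_def)
    then have "v \<in> Y" using cl by simp
    moreover have "T v = a" by (rule T_eq[OF \<open>v \<in> Y\<close> v(2)])
    ultimately show "a \<in> T ` Y" by blast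
  qed
  moreover have "T (u + v) = T u + T v" if "u \<in> Y" "v \<in> Y" for u v
  proof (rule T_eq)
    show "u + v \<in> Y" by (rule subspace_add[OF sY(1) that])
    \<comment> \<open>The sum of two vectors as a sum indexed by the two truth values.\<close>
    have "is_expansion NN x (\<Sum>b\<in>UNIV. if b then u else v) (\<lambda>n. \<Sum>b\<in>UNIV. (if b then T u else T v) n)"
      by (rule nakano.expansion_sum[OF xl]) (use T[OF that(1)] T[OF that(2)] that Yl in auto)
    moreover have "(\<lambda>n. \<Sum>b\<in>UNIV. (if b then T u else T v) n) = T u + T v"
      by (auto simp: UNIV_bool)
    ultimately show "is_expansion NN x (u + v) (T u + T v)"
      by (simp add: UNIV_bool add.commute)
  qed
  moreover have "T (r *\<^sub>R v) = r *\<^sub>R T v" if "v \<in> Y" for r v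
  proof (rule T_eq)
    show "r *\<^sub>R v \<in> Y" by (rule subspace_scale[OF sY(1) that])
    have "v \<in> nakano_l p" using that Yl by auto
    from nakano.expansion_scale[OF xl this T[OF that], of r]
    show "is_expansion NN x (r *\<^sub>R v) (r *\<^sub>R T v)" by (simp add: scaleR_fun_def)
  qed
  moreover have "inverse D * NN v \<le> c0_norm (T v) \<and> c0_norm (T v) \<le> D * NN v" if "v \<in> Y" for v
  proof
    have vl: "v \<in> nakano_l p" using that Yl by auto
    show "c0_norm (T v) \<le> D * NN v"
      by (rule c0_norm_le) (rule c0_like_expansion_coefficient[OF D xl vl T[OF that]])
    show "inverse D * NN v \<le> c0_norm (T v)"
      using c0_like_norm_expansion[OF D xl vl T[OF that]] c0_like_ge_1[OF D] by (simp add: field_simps)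
  qed
  ultimately show ?thesis
    unfolding isomorphic_spaces_def using c0_like_ge_1[OF D] by blast
qed

end

section \<open>Random signs\<close>

text \<open>The value of the sum with random signs at the sample point \<open>U\<close>: the indices in \<open>U\<close> get the sign
  plus. Averaging over \<open>Pow A\<close> is the expectation.\<close>

definition signed_sum :: "'a set \<Rightarrow> 'a set \<Rightarrow> ('a \<Rightarrow> real) \<Rightarrow> real" where
  "signed_sum U A x = (\<Sum>i\<in>A. if i \<in> U then x i else - x i)"

lemma sum_Pow_insert:
  assumes "finite A" "a \<notin> A"
  shows "(\<Sum>U\<in>Pow (insert a A). f U) = (\<Sum>U\<in>Pow A. f U + f (insert a U))"
proof -
  have "inj_on (insert a) (Pow A)" using assms(2) by (auto simp: inj_on_def)
  moreover have "Pow A \<inter> insert a ` Pow A = {}" using assms(2) by auto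
  ultimately show ?thesis
    using assms(1) by (simp add: Pow_insert sum.union_disjoint sum.reindex sum.distrib)
qed

lemma signed_sum_insert:
  assumes "finite A" "a \<notin> A" "U \<subseteq> A"
  shows "signed_sum U (insert a A) x = signed_sum U A x - x a"
    and "signed_sum (insert a U) (insert a A) x = signed_sum U A x + x a"
proof -
  have "a \<notin> U" using assms by auto
  then show "signed_sum U (insert a A) x = signed_sum U A x - x a"
    using assms by (simp add: signed_sum_def)
  have "(\<Sum>i\<in>A. if i \<in> insert a U then x i else - x i) = signed_sum U A x"
    unfolding signed_sum_def using assms(2) by (intro sum.cong) auto
  then show "signed_sum (insert a U) (insert a A) x = signed_sum U A x + x a"
    using assms by (simp add: signed_sum_def)
qed

lemma signed_sum_second_moment:
  assumes "finite A"
  shows "(\<Sum>U\<in>Pow A. (signed_sum U A x)\<^sup>2) = 2 ^ card A * (\<Sum>i\<in>A. (x i)\<^sup>2)"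
  using assms
proof (induction A rule: finite_induct)
  case empty
  then show ?case by (simp add: signed_sum_def)
next
  case (insert a A)
  have "(\<Sum>U\<in>Pow (insert a A). (signed_sum U (insert a A) x)\<^sup>2)
      = (\<Sum>U\<in>Pow A. (signed_sum U A x - x a)\<^sup>2 + (signed_sum U A x + x a)\<^sup>2)"
    unfolding sum_Pow_insert[OF insert.hyps]
    by (intro sum.cong refl) (simp add: signed_sum_insert[OF insert.hyps])
  also have "\<dots> = (\<Sum>U\<in>Pow A. 2 * (signed_sum U A x)\<^sup>2 + 2 * (x a)\<^sup>2)"
    by (intro sum.cong refl) (simp add: power2_eq_square algebra_simps)
  also have "\<dots> = 2 * (\<Sum>U\<in>Pow A. (signed_sum U A x)\<^sup>2) + 2 ^ card A * (2 * (x a)\<^sup>2)"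
    using insert.hyps by (simp add: sum.distrib card_Pow flip: sum_distrib_left)
  finally show ?case using insert by (simp add: algebra_simps)
qed

lemma signed_sum_fourth_moment:
  assumes "finite A"
  shows "(\<Sum>U\<in>Pow A. signed_sum U A x ^ 4) \<le> 3 * 2 ^ card A * (\<Sum>i\<in>A. (x i)\<^sup>2)\<^sup>2"
  using assms
proof (induction A rule: finite_induct)
  case empty
  then show ?case by (simp add: signed_sum_def)
next
  case (insert a A)
  let ?q = "\<Sum>i\<in>A. (x i)\<^sup>2"
  have "(\<Sum>U\<in>Pow (insert a A). signed_sum U (insert a A) x ^ 4)
      = (\<Sum>U\<in>Pow A. (signed_sum U A x - x a) ^ 4 + (signed_sum U A x + x a) ^ 4)"
    unfolding sum_Pow_insert[OF insert.hyps]
    by (intro sum.cong refl) (simp add: signed_sum_insert[OF insert.hyps])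
  also have "\<dots> = (\<Sum>U\<in>Pow A. 2 * signed_sum U A x ^ 4 + (12 * (x a)\<^sup>2) * (signed_sum U A x)\<^sup>2 + 2 * x a ^ 4)"
    by (intro sum.cong refl) (simp add: power4_eq_xxxx power2_eq_square algebra_simps)
  also have "\<dots> = 2 * (\<Sum>U\<in>Pow A. signed_sum U A x ^ 4)
      + (12 * (x a)\<^sup>2) * (\<Sum>U\<in>Pow A. (signed_sum U A x)\<^sup>2) + 2 ^ card A * (2 * x a ^ 4)"
    using insert.hyps by (simp add: sum.distrib card_Pow flip: sum_distrib_left)
  also have "\<dots> \<le> 2 * (3 * 2 ^ card A * ?q\<^sup>2) + (12 * (x a)\<^sup>2) * (2 ^ card A * ?q) + 2 ^ card A * (6 * x a ^ 4)"
    using insert.IH signed_sum_second_moment[OF insert.hyps(1), of x] by (intro add_mono mult_left_mono) auto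
  also have "\<dots> = 3 * 2 ^ card (insert a A) * ((x a)\<^sup>2 + ?q)\<^sup>2"
    using insert.hyps by (simp add: power4_eq_xxxx power2_eq_square algebra_simps)
  finally show ?case using insert.hyps by simp
qed

text \<open>A lower bound for \<open>\<bar>y\<bar>\<close> by even powers, whose expectations are computable. With \<open>s\<close> the
  standard deviation, the second and fourth moments still leave a positive multiple of \<open>s ^ 4\<close>.\<close>

lemma quartic_minorant:
  fixes s y :: real
  assumes "s \<ge> 0"
  shows "4 * s\<^sup>2 * y\<^sup>2 - y ^ 4 \<le> 4 * s ^ 3 * \<bar>y\<bar>"
proof -
  define t where "t = \<bar>y\<bar>"
  have t: "t \<ge> 0" by (simp add: t_def)
  have "0 \<le> t ^ 3 - 4 * s\<^sup>2 * t + 4 * s ^ 3"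
  proof (cases "t \<le> 2 * s")
    case True
    have "t ^ 3 - 4 * s\<^sup>2 * t + 4 * s ^ 3 = (t - s)\<^sup>2 * (t + 2 * s) + s\<^sup>2 * (2 * s - t)"
      by (simp add: power2_eq_square power3_eq_cube algebra_simps)
    moreover have "0 \<le> (t - s)\<^sup>2 * (t + 2 * s) + s\<^sup>2 * (2 * s - t)"
      using t assms True by simp
    ultimately show ?thesis by simp
  next
    case False
    then have "(2 * s)\<^sup>2 * t \<le> t\<^sup>2 * t" using t assms by (intro mult_right_mono power_mono) auto
    moreover have "0 \<le> s ^ 3" using assms by simp
    ultimately show ?thesis by (simp add: power2_eq_square power3_eq_cube)
  qed
  then have "0 \<le> t * (t ^ 3 - 4 * s\<^sup>2 * t + 4 * s ^ 3)" using t by simp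
  then have "4 * s\<^sup>2 * t\<^sup>2 - t ^ 4 \<le> 4 * s ^ 3 * t"
    by (simp add: power2_eq_square power3_eq_cube power4_eq_xxxx algebra_simps)
  then show ?thesis by (simp add: t_def)
qed

text \<open>Khintchine's inequality between the first moment and the \<open>\<ell>\<^sub>2\<close>-norm, with constant four, from the
  second and fourth moments.\<close>

lemma khintchine_L1:
  assumes A: "finite A"
  shows "2 ^ card A * sqrt (\<Sum>i\<in>A. (x i)\<^sup>2) \<le> 4 * (\<Sum>U\<in>Pow A. \<bar>signed_sum U A x\<bar>)"
proof -
  define s where "s = sqrt (\<Sum>i\<in>A. (x i)\<^sup>2)"
  have s: "s \<ge> 0" "s\<^sup>2 = (\<Sum>i\<in>A. (x i)\<^sup>2)" by (simp_all add: s_def sum_nonneg)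
  let ?S = "\<lambda>U. signed_sum U A x"
  have "2 ^ card A * s ^ 4 = 4 * s\<^sup>2 * (2 ^ card A * s\<^sup>2) - 3 * 2 ^ card A * (s\<^sup>2)\<^sup>2"
    by (simp add: power2_eq_square power4_eq_xxxx)
  also have "\<dots> \<le> 4 * s\<^sup>2 * (\<Sum>U\<in>Pow A. (?S U)\<^sup>2) - (\<Sum>U\<in>Pow A. ?S U ^ 4)"
    using signed_sum_second_moment[OF A, of x] signed_sum_fourth_moment[OF A, of x] by (simp add: s(2))
  also have "\<dots> = (\<Sum>U\<in>Pow A. 4 * s\<^sup>2 * (?S U)\<^sup>2 - ?S U ^ 4)"
    by (simp add: sum_subtractf sum_distrib_left)
  also have "\<dots> \<le> (\<Sum>U\<in>Pow A. 4 * s ^ 3 * \<bar>?S U\<bar>)"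
    by (intro sum_mono quartic_minorant s)
  also have "\<dots> = s ^ 3 * (4 * (\<Sum>U\<in>Pow A. \<bar>?S U\<bar>))"
    by (simp add: sum_distrib_left mult_ac)
  finally have "s ^ 3 * (2 ^ card A * s) \<le> s ^ 3 * (4 * (\<Sum>U\<in>Pow A. \<bar>?S U\<bar>))"
    by (simp add: power3_eq_cube power4_eq_xxxx mult_ac)
  then show ?thesis
  proof (cases "s = 0")
    case True
    then show ?thesis unfolding s_def[symmetric] by (simp add: sum_nonneg)
  next
    case False
    then have "s ^ 3 > 0" using s(1) by simp
    with \<open>s ^ 3 * _ \<le> s ^ 3 * _\<close> show ?thesis unfolding s_def[symmetric]
      by (simp only: mult_le_cancel_left_pos)
  qed
qed

section \<open>The growth of the exponents when a greedy basis exists\<close>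

context nakano_space
begin

lemma norm_restrict_le_l2:
  assumes A: "finite A" and p2: "\<And>i. i \<in> A \<Longrightarrow> 2 \<le> p i"
  shows "NN (restrict_seq A v) \<le> sqrt (\<Sum>i\<in>A. (v i)\<^sup>2)"
proof (rule dense_ge)
  fix t assume t: "sqrt (\<Sum>i\<in>A. (v i)\<^sup>2) < t"
  have t0: "t > 0" using t order.strict_trans1[OF real_sqrt_ge_zero[OF sum_nonneg] t] by simp
  have sq: "(\<Sum>i\<in>A. (v i)\<^sup>2) \<le> t\<^sup>2"
    using t t0 by (metis less_imp_le real_sqrt_le_iff real_sqrt_unique)
  have "gauge_ball t (restrict_seq A v)"
  proof (rule gauge_ballI[OF t0])
    fix F :: "nat set" assume F: "finite F"
    have "\<bar>restrict_seq A v i / t\<bar> powr p i \<le> (if i \<in> A then (v i / t)\<^sup>2 else 0)" for i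
    proof (cases "i \<in> A")
      case True
      have "(v i)\<^sup>2 \<le> t\<^sup>2"
        using member_le_sum[OF True _ A, of "\<lambda>i. (v i)\<^sup>2"] sq by simp
      then have "\<bar>v i / t\<bar> \<le> 1" using t0 by (simp add: abs_le_square_iff[symmetric])
      then have "\<bar>v i / t\<bar> powr p i \<le> \<bar>v i / t\<bar> powr 2"
        using p2[OF True] by (intro powr_mono') auto
      also have "\<bar>v i / t\<bar> powr 2 = (v i / t)\<^sup>2"
        using powr_numeral[of "\<bar>v i / t\<bar>" "Num.Bit0 Num.One"] by (simp only: power2_abs abs_ge_zero)
      finally show ?thesis using True by (simp add: restrict_seq_def)
    qed (simp add: restrict_seq_def)
    then have "(\<Sum>i\<in>F. \<bar>restrict_seq A v i / t\<bar> powr p i) \<le> (\<Sum>i\<in>F. if i \<in> A then (v i / t)\<^sup>2 else 0)"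
      by (rule sum_mono)
    also have "\<dots> = (\<Sum>i\<in>F \<inter> A. (v i / t)\<^sup>2)" using F by (simp add: sum.If_cases)
    also have "\<dots> \<le> (\<Sum>i\<in>A. (v i / t)\<^sup>2)" using A by (intro sum_mono2) auto
    also have "\<dots> = (\<Sum>i\<in>A. (v i)\<^sup>2) / t\<^sup>2" by (simp add: power_divide sum_divide_distrib)
    also have "\<dots> \<le> 1" using sq t0 by simp
    finally show "(\<Sum>i\<in>F. \<bar>restrict_seq A v i / t\<bar> powr p i) \<le> 1" .
  qed
  then show "NN (restrict_seq A v) \<le> t" by (rule nakano_norm_le)
qed

text \<open>Let \<open>z\<close> be in the unit ball. An entry above \<open>t\<close> contributes at least \<open>t ^ k\<close> to the modular, so
  that \<open>\<bar>z i\<bar> \<le> 1\<close> is at most \<open>1 / t ^ k\<close> times its contribution; all other entries are at most \<open>t\<close>.\<close>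

lemma sum_abs_le_norm:
  assumes A: "finite A" and pk: "\<And>i. i \<in> A \<Longrightarrow> p i \<le> real k"
    and t: "0 < t" "t \<le> 1" and v: "v \<in> nakano_l p"
  shows "(\<Sum>i\<in>A. \<bar>v i\<bar>) \<le> (t * real (card A) + 1 / t ^ k) * NN v"
proof -
  define W where "W = t * real (card A) + 1 / t ^ k"
  have W: "W > 0" unfolding W_def using t by (intro add_nonneg_pos) auto
  have "(\<Sum>i\<in>A. \<bar>v i\<bar>) / W \<le> NN v"
  proof (rule dense_ge)
    fix s assume "NN v < s"
    then have s: "gauge_ball s v" by (rule gauge_ball_of_norm_less[OF v])
    then have s0: "s > 0" by (simp add: gauge_ball_def)
    have "\<bar>v i / s\<bar> \<le> t + (1 / t ^ k) * \<bar>v i / s\<bar> powr p i" if "i \<in> A" for i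
    proof (cases "\<bar>v i / s\<bar> \<le> t")
      case True
      then show ?thesis using t by (intro order_trans[OF True]) simp
    next
      case False
      have "t ^ k = t powr real k" using t by (simp add: powr_realpow)
      also have "\<dots> \<le> t powr p i" using t pk[OF that] by (intro powr_mono') auto
      also have "\<dots> \<le> \<bar>v i / s\<bar> powr p i"
        using t False p_ge_1[of i] by (intro powr_mono2) auto
      finally have "1 \<le> (1 / t ^ k) * \<bar>v i / s\<bar> powr p i" using t by (simp add: field_simps)
      moreover have "\<bar>v i / s\<bar> \<le> 1" using gauge_ball_coordinate[OF s, of i] s0 by simp
      ultimately show ?thesis using t by linarith
    qed
    then have "(\<Sum>i\<in>A. \<bar>v i / s\<bar>) \<le> (\<Sum>i\<in>A. t + (1 / t ^ k) * \<bar>v i / s\<bar> powr p i)"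
      by (rule sum_mono)
    also have "\<dots> = t * real (card A) + (1 / t ^ k) * (\<Sum>i\<in>A. \<bar>v i / s\<bar> powr p i)"
      by (simp only: sum.distrib sum_distrib_left sum_constant) simp
    also have "\<dots> \<le> t * real (card A) + (1 / t ^ k) * 1"
      using gauge_ballD[OF s A] t by (intro add_mono mult_left_mono) auto
    finally have "(\<Sum>i\<in>A. \<bar>v i / s\<bar>) \<le> W" by (simp add: W_def)
    moreover have "(\<Sum>i\<in>A. \<bar>v i / s\<bar>) = (\<Sum>i\<in>A. \<bar>v i\<bar>) / s"
      using s0 by (simp add: sum_divide_distrib)
    ultimately have "(\<Sum>i\<in>A. \<bar>v i\<bar>) / s \<le> W" by (simp only:)
    then show "(\<Sum>i\<in>A. \<bar>v i\<bar>) / W \<le> s"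
      unfolding pos_divide_le_eq[OF s0] pos_divide_le_eq[OF W] by (simp only: mult.commute)
  qed
  then show ?thesis using W by (simp add: W_def[symmetric] field_simps)
qed

end

context nakano_space_inf
begin

text \<open>This bounds the \<open>\<ell>\<^sub>1\<close>-norm of the functional that a choice of signs on \<open>A\<close> induces on \<open>c\<^sub>0\<close>
  through \<open>x\<close>. Multiplying by the signs \<open>\<theta> j\<close> turns the sum of absolute values into the value of the
  functional at \<open>w = (\<Sum>j<m. \<theta> j *\<^sub>R x j)\<close>, and \<open>w\<close> has norm at most \<open>D\<close>.\<close>

lemma c0_like_sum_signed:
  assumes x: "c0_like x D" "range x \<subseteq> nakano_l p" and A: "finite A"
    and W: "\<And>v. v \<in> nakano_l p \<Longrightarrow> (\<Sum>i\<in>A. \<bar>v i\<bar>) \<le> W * NN v" "W \<ge> 0"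
  shows "(\<Sum>j<m. \<bar>signed_sum U A (x j)\<bar>) \<le> W * D"
proof -
  define \<theta> where "\<theta> j = sgn (signed_sum U A (x j))" for j
  define w where "w = (\<Sum>j<m. \<theta> j *\<^sub>R x j)"
  have wl: "w \<in> nakano_l p" unfolding w_def by (rule nakano.combination_in_carrier[OF x(2)])
  have "NN w \<le> D * 1"
    unfolding w_def by (rule c0_like_norm[OF x(1)]) (auto simp: \<theta>_def abs_sgn_eq)
  then have "W * NN w \<le> W * D" using W(2) by (intro mult_left_mono) auto
  have "(\<Sum>j<m. \<bar>signed_sum U A (x j)\<bar>) = (\<Sum>j<m. \<theta> j * signed_sum U A (x j))"
    by (simp add: \<theta>_def abs_sgn mult.commute)
  also have "\<dots> = (\<Sum>j<m. \<Sum>i\<in>A. if i \<in> U then \<theta> j * x j i else - (\<theta> j * x j i))"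
    by (simp add: signed_sum_def sum_distrib_left if_distrib cong: if_cong)
  also have "\<dots> = (\<Sum>i\<in>A. \<Sum>j<m. if i \<in> U then \<theta> j * x j i else - (\<theta> j * x j i))"
    by (rule sum.swap)
  also have "\<dots> = (\<Sum>i\<in>A. if i \<in> U then w i else - w i)"
    by (intro sum.cong refl) (simp add: w_def combination_apply sum_negf)
  also have "\<dots> \<le> (\<Sum>i\<in>A. \<bar>w i\<bar>)" by (intro sum_mono) auto
  also have "\<dots> \<le> W * NN w" by (rule W(1)[OF wl])
  finally show ?thesis using \<open>W * NN w \<le> W * D\<close> by linarith
qed

text \<open>The trace of the coordinate projection onto \<open>A\<close>, computed in two ways. In the unit vectors it is
  \<open>card A\<close>. In the basis \<open>x\<close> its \<open>j\<close>-th diagonal entry is the \<open>j\<close>-th coefficient of the projection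
  of \<open>x j\<close>, which is at most \<open>D\<close> times the norm of this projection. The norm is at most the
  \<open>\<ell>\<^sub>2\<close>-norm, and Khintchine's inequality replaces it by an average of signed sums, whose sum over
  \<open>j\<close> is bounded for each choice of signs.\<close>

lemma trace_estimate:
  assumes x: "c0_like x D" "range x \<subseteq> nakano_l p"
    and expand: "\<And>i. is_expansion NN x (unit_vector i) (a i)"
    and A: "finite A" and p2: "\<And>i. i \<in> A \<Longrightarrow> 2 \<le> p i"
    and W: "\<And>v. v \<in> nakano_l p \<Longrightarrow> (\<Sum>i\<in>A. \<bar>v i\<bar>) \<le> W * NN v" "W \<ge> 0"
  shows "real (card A) \<le> 4 * D\<^sup>2 * W"
proof -
  have D: "D \<ge> 1" by (rule c0_like_ge_1[OF x(1)])
  have xl: "x j \<in> nakano_l p" for j using x(2) by auto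
  have l2: "(\<Sum>j<m. NN (restrict_seq A (x j))) \<le> 4 * (W * D)" for m
  proof -
    have "2 ^ card A * (\<Sum>j<m. NN (restrict_seq A (x j)))
        \<le> (\<Sum>j<m. 2 ^ card A * sqrt (\<Sum>i\<in>A. (x j i)\<^sup>2))"
      unfolding sum_distrib_left by (intro sum_mono mult_left_mono norm_restrict_le_l2[OF A p2]) auto
    also have "\<dots> \<le> (\<Sum>j<m. 4 * (\<Sum>U\<in>Pow A. \<bar>signed_sum U A (x j)\<bar>))"
      by (intro sum_mono khintchine_L1[OF A])
    also have "\<dots> = 4 * (\<Sum>U\<in>Pow A. \<Sum>j<m. \<bar>signed_sum U A (x j)\<bar>)"
      unfolding sum_distrib_left[symmetric] by (subst sum.swap) (rule refl)
    also have "\<dots> \<le> 4 * (\<Sum>U\<in>Pow A. W * D)"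
      by (intro mult_left_mono sum_mono c0_like_sum_signed[OF x A W]) auto
    also have "\<dots> = 2 ^ card A * (4 * (W * D))" using A by (simp add: card_Pow)
    finally show ?thesis by simp
  qed
  have coeff: "(\<Sum>i\<in>A. a i j * x j i) \<le> D * NN (restrict_seq A (x j))" for j
  proof -
    have "is_expansion NN x (\<Sum>i\<in>A. x j i *\<^sub>R unit_vector i) (\<lambda>n. \<Sum>i\<in>A. x j i * a i n)"
      by (intro nakano.expansion_sum x conjI nakano.carrier_scale unit_vector_in_l
          nakano.expansion_scale expand)
    then have "is_expansion NN x (restrict_seq A (x j)) (\<lambda>n. \<Sum>i\<in>A. x j i * a i n)"
      by (simp add: restrict_seq_eq_sum[OF A])
    from c0_like_expansion_coefficient[OF x restrict_seq_in_l[OF xl] this, of j]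
    show ?thesis by (simp add: mult.commute)
  qed
  have bound: "(\<Sum>i\<in>A. \<Sum>j<m. a i j * x j i) \<le> 4 * D\<^sup>2 * W" for m
  proof -
    have "(\<Sum>i\<in>A. \<Sum>j<m. a i j * x j i) = (\<Sum>j<m. \<Sum>i\<in>A. a i j * x j i)" by (rule sum.swap)
    also have "\<dots> \<le> (\<Sum>j<m. D * NN (restrict_seq A (x j)))" by (intro sum_mono coeff)
    also have "\<dots> = D * (\<Sum>j<m. NN (restrict_seq A (x j)))" by (simp add: sum_distrib_left)
    also have "\<dots> \<le> D * (4 * (W * D))" using D l2 by (intro mult_left_mono) auto
    finally show ?thesis by (simp add: power2_eq_square mult_ac)
  qed
  have "(\<lambda>m. \<Sum>j<m. a i j * x j i) \<longlonglongrightarrow> 1" for i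
  proof -
    let ?r = "\<lambda>m. unit_vector i - (\<Sum>j<m. a i j *\<^sub>R x j)"
    have "\<bar>(\<Sum>j<m. a i j * x j i) - 1\<bar> \<le> NN (?r m)" for m
    proof -
      have "?r m \<in> nakano_l p"
        by (intro nakano.carrier_diff unit_vector_in_l nakano.combination_in_carrier x)
      from coordinate_le_norm[OF this, of i] show ?thesis
        by (simp add: combination_apply unit_vector_def abs_minus_commute)
    qed
    then have "(\<lambda>m. (\<Sum>j<m. a i j * x j i) - 1) \<longlonglongrightarrow> 0"
      by (intro Lim_null_comparison[OF always_eventually expand[unfolded is_expansion_def]]) auto
    then show ?thesis by (simp add: LIM_zero_cancel)
  qed
  then have "(\<lambda>m. \<Sum>i\<in>A. \<Sum>j<m. a i j * x j i) \<longlonglongrightarrow> (\<Sum>i\<in>A. 1)"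
    by (intro tendsto_sum)
  then have "(\<Sum>i\<in>A. 1) \<le> 4 * D\<^sup>2 * W"
    by (rule LIMSEQ_le_const2) (use bound in blast)
  then show ?thesis by simp
qed

lemma finite_p_le: "finite {i. p i \<le> c}"
proof -
  have "\<forall>\<^sub>F k in sequentially. c + 1 \<le> p k" using p_tends_to_inf by (simp add: filterlim_at_top)
  then obtain n where n: "\<forall>k\<ge>n. c + 1 \<le> p k" by (auto simp: eventually_sequentially)
  have "{i. p i \<le> c} \<subseteq> {..<n}"
  proof
    fix i assume "i \<in> {i. p i \<le> c}"
    then have "\<not> c + 1 \<le> p i" by simp
    then show "i \<in> {..<n}" using n by (meson lessThan_iff not_le)
  qed
  then show ?thesis by (rule finite_subset) simp
qed

text \<open>For \<open>t = 1 / (2 * E)\<close> the first term of the bound from \<open>sum_abs_le_norm\<close>, inserted in the trace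
  estimate, is half of \<open>card A\<close> and can be absorbed.\<close>

lemma c0_like_basis_counting:
  assumes x: "c0_like x D" "range x \<subseteq> nakano_l p"
    and expand: "\<And>i. is_expansion NN x (unit_vector i) (a i)"
  shows "real (card {i. 2 \<le> p i \<and> p i \<le> real k}) \<le> (8 * D\<^sup>2) ^ Suc k"
proof -
  define E where "E = 4 * D\<^sup>2"
  define A where "A = {i. 2 \<le> p i \<and> p i \<le> real k}"
  define t where "t = 1 / (2 * E)"
  have "D\<^sup>2 \<ge> 1" using c0_like_ge_1[OF x(1)] by (simp add: one_le_power)
  then have E: "E \<ge> 4" by (simp add: E_def)
  have t: "0 < t" "t \<le> 1" using E by (auto simp: t_def)
  have A: "finite A" unfolding A_def by (rule finite_subset[OF _ finite_p_le[of "real k"]]) auto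
  have "real (card A) \<le> E * (t * real (card A) + 1 / t ^ k)"
    unfolding E_def
    by (rule trace_estimate[OF x expand A _ sum_abs_le_norm[OF A _ t]])
      (use t in \<open>auto simp: A_def\<close>)
  also have "\<dots> = real (card A) / 2 + E * (2 * E) ^ k"
    using E by (simp add: t_def power_divide field_simps)
  finally have "real (card A) \<le> (2 * E) ^ Suc k" by simp
  then show ?thesis by (simp add: A_def E_def mult.commute)
qed

text \<open>The finitely many exponents up to two contribute at most one each. Above two, the indices whose
  exponent has integer part \<open>k\<close> are at most \<open>E ^ (k + 2)\<close> in number, and each
  contributes at most \<open>(1 / (2 * E)) ^ k\<close>. So the layers are dominated by a geometric series with
  ratio one half.\<close>

lemma counting_imp_modular_bounded:
  assumes count: "\<And>k. real (card {i. 2 \<le> p i \<and> p i \<le> real k}) \<le> E ^ Suc k" and E: "E \<ge> 1"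
  shows "modular_bounded p (real (card {i. p i \<le> 2}) + 2 * E\<^sup>2) (\<lambda>_. 1 / (2 * E))"
  unfolding modular_bounded_def
proof (intro allI impI)
  fix F :: "nat set" assume F: "finite F"
  define r where "r = 1 / (2 * E)"
  have r: "0 < r" "r \<le> 1" using E by (auto simp: r_def)
  define G where "G = {i \<in> F. 2 < p i}"
  define g where "g i = nat \<lfloor>p i\<rfloor>" for i
  have G: "finite G" "G \<subseteq> F" using F by (auto simp: G_def)
  have split: "(\<Sum>i\<in>F. r powr p i) = (\<Sum>i\<in>F - G. r powr p i) + (\<Sum>i\<in>G. r powr p i)"
    using sum.subset_diff[OF G(2) F] by simp
  have "(\<Sum>i\<in>F - G. r powr p i) \<le> (\<Sum>i\<in>F - G. 1)"
    using r p_ge_1 order_trans[OF zero_le_one p_ge_1] by (intro sum_mono powr_le1) auto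
  also have "\<dots> \<le> real (card {i. p i \<le> 2})"
    using card_mono[OF finite_p_le[of 2], of "F - G"] by (force simp: G_def)
  finally have low: "(\<Sum>i\<in>F - G. r powr p i) \<le> real (card {i. p i \<le> 2})" .
  have layer: "(\<Sum>i\<in>{i \<in> G. g i = k}. r powr p i) \<le> E\<^sup>2 * (1 / 2) ^ k" for k
  proof -
    have pk: "real k \<le> p i" "p i \<le> real (Suc k)" if "g i = k" for i
      using that p_ge_1[of i] unfolding g_def by linarith+
    have "(\<Sum>i\<in>{i \<in> G. g i = k}. r powr p i) \<le> (\<Sum>i\<in>{i \<in> G. g i = k}. r ^ k)"
    proof (rule sum_mono)
      fix i assume "i \<in> {i \<in> G. g i = k}"
      then have "r powr p i \<le> r powr real k" using r pk(1)[of i] by (intro powr_mono') auto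
      then show "r powr p i \<le> r ^ k" using r by (simp add: powr_realpow)
    qed
    also have "\<dots> = real (card {i \<in> G. g i = k}) * r ^ k" by simp
    also have "\<dots> \<le> E ^ Suc (Suc k) * r ^ k"
    proof (rule mult_right_mono)
      have "finite {i. 2 \<le> p i \<and> p i \<le> real (Suc k)}"
        by (rule finite_subset[OF _ finite_p_le[of "real (Suc k)"]]) auto
      then have "card {i \<in> G. g i = k} \<le> card {i. 2 \<le> p i \<and> p i \<le> real (Suc k)}"
        by (rule card_mono) (use pk(2) in \<open>auto simp: G_def\<close>)
      then show "real (card {i \<in> G. g i = k}) \<le> E ^ Suc (Suc k)"
        using count[of "Suc k"] by linarith
    qed (use r in simp)
    also have "\<dots> = E\<^sup>2 * (1 / 2) ^ k"
      using E by (simp add: r_def power_divide power_mult_distrib power2_eq_square)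
    finally show ?thesis .
  qed
  have "(\<Sum>i\<in>G. r powr p i) = (\<Sum>k\<in>g ` G. \<Sum>i\<in>{i \<in> G. g i = k}. r powr p i)"
    by (rule sum.image_gen[OF G(1)])
  also have "\<dots> \<le> (\<Sum>k\<in>g ` G. E\<^sup>2 * (1 / 2) ^ k)" by (intro sum_mono layer)
  also have "\<dots> = E\<^sup>2 * (\<Sum>k\<in>g ` G. (1 / 2) ^ k)" by (simp add: sum_distrib_left)
  also have "\<dots> \<le> E\<^sup>2 * (\<Sum>k. (1 / 2) ^ k)"
    using G(1) by (intro mult_left_mono sum_le_suminf summable_geometric) auto
  also have "\<dots> = 2 * E\<^sup>2" by (simp add: suminf_geometric)
  finally have high: "(\<Sum>i\<in>G. r powr p i) \<le> 2 * E\<^sup>2" .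
  have "\<bar>1 / (2 * E)\<bar> = r" using E by (simp add: r_def)
  then show "(\<Sum>i\<in>F. \<bar>1 / (2 * E)\<bar> powr p i) \<le> real (card {i. p i \<le> 2}) + 2 * E\<^sup>2"
    using split low high by simp
qed

end

section \<open>When the Nakano space is the space of null sequences\<close>

context nakano_space
begin

text \<open>If \<open>\<bar>v i\<bar> \<le> s\<close> for all \<open>i\<close>, then \<open>v / s\<close> scaled down by \<open>K\<close> is dominated by the constant sequence
  \<open>r / L'\<close>, and the factor \<open>1 / L'\<close> brings the modular of \<open>r\<close> below one by convexity.\<close>

lemma modular_bounded_imp_sup_dominates:
  assumes r: "0 < r" "modular_bounded p L (\<lambda>_. r)"
  shows "\<exists>K\<ge>1. \<forall>v s. s > 0 \<longrightarrow> (\<forall>i. \<bar>v i\<bar> \<le> s) \<longrightarrow> gauge_ball (K * s) v"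
proof -
  define L' where "L' = max 1 L"
  define K where "K = max 1 (L' / r)"
  have L': "L' \<ge> 1" "L \<le> L'" by (auto simp: L'_def)
  have K: "K \<ge> 1" "1 / K \<le> r / L'" using r L' by (auto simp: K_def field_simps max_def)
  have "gauge_ball (K * s) v" if s: "s > 0" and v: "\<And>i. \<bar>v i\<bar> \<le> s" for v s
  proof (rule gauge_ballI)
    show "K * s > 0" using K s by simp
    fix F :: "nat set" assume F: "finite F"
    have "\<bar>v i / (K * s)\<bar> powr p i \<le> (1 / L') * r powr p i" for i
    proof -
      have "\<bar>v i\<bar> / s * (1 / K) \<le> 1 * (r / L')"
        using v[of i] s K by (intro mult_mono) auto
      then have "\<bar>v i / (K * s)\<bar> \<le> \<bar>(1 / L') * r\<bar>"
        using s K r L' by (simp add: abs_mult mult.commute)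
      then have "\<bar>v i / (K * s)\<bar> powr p i \<le> \<bar>(1 / L') * r\<bar> powr p i"
        using p_ge_1[of i] by (intro powr_mono2) auto
      also have "\<dots> \<le> (1 / L') powr 1 * \<bar>r\<bar> powr p i"
        using L' p_ge_1 by (intro powr_contract) auto
      finally show ?thesis using L' r by simp
    qed
    then have "(\<Sum>i\<in>F. \<bar>v i / (K * s)\<bar> powr p i) \<le> (1 / L') * (\<Sum>i\<in>F. r powr p i)"
      unfolding sum_distrib_left by (rule sum_mono)
    also have "\<dots> \<le> (1 / L') * L'"
    proof (rule mult_left_mono)
      have "(\<Sum>i\<in>F. \<bar>r\<bar> powr p i) \<le> L" using r(2) F by (simp add: modular_bounded_def)
      then show "(\<Sum>i\<in>F. r powr p i) \<le> L'" using r(1) L' by simp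
    qed (use L' in simp)
    finally show "(\<Sum>i\<in>F. \<bar>v i / (K * s)\<bar> powr p i) \<le> 1" using L' by simp
  qed
  with K(1) show ?thesis by (intro exI[of _ K]) simp
qed

lemma nakano_h_subset_c0: "nakano_h p \<subseteq> c0_space"
proof
  fix v assume v: "v \<in> nakano_h p"
  then have vl: "v \<in> nakano_l p" using nakano_h_subset_l by auto
  have "v \<longlonglongrightarrow> 0"
  proof (rule LIMSEQ_I)
    fix e :: real assume "e > 0"
    then obtain n0 where "\<forall>n\<ge>n0. NN (restrict_seq {n..} v) < e" using nakano_h_tail_small[OF v] by blast
    moreover have "\<bar>v n\<bar> \<le> NN (restrict_seq {n..} v)" for n
      using coordinate_le_norm[OF restrict_seq_in_l[OF vl], of "{n..}" n] by (simp add: restrict_seq_def)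
    ultimately have "norm (v n - 0) < e" if "n \<ge> n0" for n
      using that by (metis diff_zero order.strict_trans1 real_norm_def)
    then show "\<exists>no. \<forall>n\<ge>no. norm (v n - 0) < e" by blast
  qed
  then show "v \<in> c0_space" by (simp add: c0_space_def)
qed

lemma modular_bounded_imp_h_eq_c0:
  assumes r: "0 < r" "modular_bounded p L (\<lambda>_. r)"
  shows "nakano_h p = c0_space \<and> equivalent_norms_on c0_space NN c0_norm"
proof -
  obtain K where K: "K \<ge> 1" "\<forall>v s. s > 0 \<longrightarrow> (\<forall>i. \<bar>v i\<bar> \<le> s) \<longrightarrow> gauge_ball (K * s) v"
    using modular_bounded_imp_sup_dominates[OF r] by (elim exE conjE)
  have ball: "gauge_ball (K * s) v" if v: "v \<in> c0_space" and s: "c0_norm v < s" for v s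
  proof (rule K(2)[rule_format])
    have "\<bar>v i\<bar> < s" for i using abs_le_c0_norm[OF v, of i] s by (rule order.strict_trans1)
    then show "\<bar>v i\<bar> \<le> s" for i by (simp add: less_imp_le)
    from \<open>\<bar>v 0\<bar> < s\<close> show "s > 0" by (rule order.strict_trans1[OF abs_ge_zero])
  qed
  have c0l: "v \<in> nakano_l p" if "v \<in> c0_space" for v
    using ball[OF that, of "c0_norm v + 1"] gauge_ball_in_l by simp
  have "NN v \<le> K * c0_norm v" if v: "v \<in> c0_space" for v
  proof -
    have "NN v / K \<le> c0_norm v"
    proof (rule dense_ge)
      fix s assume "c0_norm v < s"
      from nakano_norm_le[OF ball[OF v this]] show "NN v / K \<le> s" using K(1) by (simp add: field_simps)
    qed
    then show ?thesis using K(1) by (simp add: field_simps)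
  qed
  note upper = this
  have lower: "c0_norm v \<le> NN v" if "v \<in> nakano_l p" for v
    by (rule c0_norm_le) (rule coordinate_le_norm[OF that])
  have "v \<in> nakano_h p" if v: "v \<in> c0_space" for v
  proof -
    have "\<exists>u\<in>span (range unit_vector). NN (v - u) < \<epsilon>" if e: "\<epsilon> > 0" for \<epsilon>
    proof -
      have "(\<lambda>m. K * c0_norm (v - restrict_seq {..<m} v)) \<longlonglongrightarrow> K * 0"
        by (intro tendsto_mult_left c0_tail_norm v)
      then obtain m where m: "norm (K * c0_norm (v - restrict_seq {..<m} v) - K * 0) < \<epsilon>"
        using LIMSEQ_D[OF _ e] by blast
      have "v - restrict_seq {..<m} v \<in> c0_space"
        by (intro subspace_diff[OF subspace_c0] v restrict_seq_in_c0) simp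
      from upper[OF this] m have "NN (v - restrict_seq {..<m} v) < \<epsilon>" by simp
      moreover have "restrict_seq {..<m} v \<in> span (range unit_vector)"
        unfolding restrict_seq_eq_sum[OF finite_lessThan] by (intro span_sum span_scale span_base) auto
      ultimately show ?thesis by (rule bexI)
    qed
    then show ?thesis unfolding nakano_h_eq norm_closure_def using c0l[OF v] by blast
  qed
  then have "nakano_h p = c0_space" using nakano_h_subset_c0 by auto
  moreover have "equivalent_norms_on c0_space NN c0_norm"
    unfolding equivalent_norms_on_def
  proof (intro exI[of _ K] conjI ballI)
    fix v assume v: "v \<in> c0_space"
    show "inverse K * NN v \<le> c0_norm v" using upper[OF v] K(1) by (simp add: field_simps)
    have vl: "v \<in> nakano_l p" by (rule c0l[OF v])
    have "1 * NN v \<le> K * NN v" using K(1) nakano_norm_ge_0[OF vl] by (intro mult_right_mono) auto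
    then show "c0_norm v \<le> K * NN v" using lower[OF vl] by simp
  qed (rule K(1))
  ultimately show ?thesis ..
qed

lemma normed_subspace_h: "normed_subspace NN (nakano_h p)"
proof
  show "subspace (nakano_h p)" by (rule subspace_nakano_h)
  have l: "u \<in> nakano_l p" if "u \<in> nakano_h p" for u using that nakano_h_subset_l by auto
  show "NN (u + v) \<le> NN u + NN v" if "u \<in> nakano_h p" "v \<in> nakano_h p" for u v
    by (rule nakano.norm_triangle[OF l[OF that(1)] l[OF that(2)]])
  show "NN (c *\<^sub>R u) = \<bar>c\<bar> * NN u" if "u \<in> nakano_h p" for c u
    by (rule nakano.norm_scale[OF l[OF that]])
  show "u = 0" if "u \<in> nakano_h p" "NN u = 0" for u
    by (rule nakano.norm_definite[OF l[OF that(1)] that(2)])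
qed

lemma closed_subspace_h: "closed_subspace NN (nakano_h p) (nakano_h p)"
  using normed_subspace.subset_norm_closure[OF normed_subspace_h, of "nakano_h p"]
    normed_subspace.norm_closure_subset[OF normed_subspace_h, of "nakano_h p"] subspace_nakano_h
  by (simp add: closed_subspace_def antisym)

end

section \<open>Spaces with a greedy basis\<close>

context nakano_space_inf
begin

text \<open>Expanding the unit vectors in the greedy basis makes the trace estimate available.\<close>

lemma greedy_basis_imp_h_eq_c0:
  assumes x: "greedy_basis NN (nakano_h p) x"
  shows "nakano_h p = c0_space \<and> equivalent_norms_on c0_space NN c0_norm"
proof -
  have sb: "schauder_basis NN (nakano_h p) x" using x by (simp add: greedy_basis_def)
  then have xl: "range x \<subseteq> nakano_l p" using nakano_h_subset_l by (auto simp: schauder_basis_def)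
  obtain D where D: "c0_like x D"
    using greedy_basis_c0_like[OF subspace_nakano_h order.refl x] by (elim exE)
  have "\<exists>a. is_expansion NN x (unit_vector i) a" for i
    using sb unit_vector_in_h[of i] unfolding schauder_basis_def by blast
  then obtain a where a: "\<And>i. is_expansion NN x (unit_vector i) (a i)" by metis
  have "8 * D\<^sup>2 \<ge> 1" using one_le_power[OF c0_like_ge_1[OF D], of 2] by simp
  from counting_imp_modular_bounded[OF c0_like_basis_counting[OF D xl a] this] this
  show ?thesis by (intro modular_bounded_imp_h_eq_c0) auto
qed

lemma greedy_basic_sequence_equivalent_c0:
  assumes x: "greedy_basic_sequence NN (nakano_h p) x"
  shows "equivalent_sequences NN x c0_norm unit_vector"
proof -
  let ?Y = "norm_closure NN (nakano_h p) (span (range x))"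
  have xh: "range x \<subseteq> nakano_h p" and g: "greedy_basis NN ?Y x"
    using x by (auto simp: greedy_basic_sequence_def closed_span_def)
  have "subspace ?Y"
    by (intro normed_subspace.subspace_norm_closure[OF normed_subspace_h] subspace_span
        span_minimal xh subspace_nakano_h)
  moreover have "?Y \<subseteq> nakano_h p" by (rule normed_subspace.norm_closure_subset[OF normed_subspace_h])
  ultimately have "\<exists>D. c0_like x D" by (rule greedy_basis_c0_like[OF _ _ g])
  then obtain D where "c0_like x D" by (elim exE)
  then show ?thesis by (rule c0_like_equivalent)
qed

lemma subspace_greedy_basis_iff:
  assumes Y: "closed_subspace NN (nakano_h p) Y"
  shows "(\<exists>x. greedy_basis NN Y x) \<longleftrightarrow> isomorphic_spaces NN Y c0_norm c0_space"
proof
  assume "\<exists>x. greedy_basis NN Y x"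
  then show "isomorphic_spaces NN Y c0_norm c0_space"
    using greedy_basis_imp_isomorphic_c0[OF Y] by (elim exE)
next
  assume "isomorphic_spaces NN Y c0_norm c0_space"
  moreover have "subspace Y" "Y \<subseteq> nakano_l p"
    using Y nakano_h_subset_l by (auto simp: closed_subspace_def)
  ultimately show "\<exists>x. greedy_basis NN Y x" by (intro nakano.isomorphic_c0_imp_greedy_basis)
qed

lemma h_greedy_basis_iff:
  "(\<exists>x. greedy_basis NN (nakano_h p) x) \<longleftrightarrow>
    nakano_h p = c0_space \<and> equivalent_norms_on c0_space NN c0_norm"
proof
  assume "\<exists>x. greedy_basis NN (nakano_h p) x"
  then show "nakano_h p = c0_space \<and> equivalent_norms_on c0_space NN c0_norm"
    using greedy_basis_imp_h_eq_c0 by (elim exE)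
next
  assume *: "nakano_h p = c0_space \<and> equivalent_norms_on c0_space NN c0_norm"
  then have "isomorphic_spaces NN (nakano_h p) c0_norm c0_space"
    unfolding isomorphic_spaces_def equivalent_norms_on_def by (intro exI[of _ "\<lambda>v. v"]) (auto simp: bij_betw_def)
  then show "\<exists>x. greedy_basis NN (nakano_h p) x"
    using subspace_greedy_basis_iff[OF closed_subspace_h] by simp
qed

end

theorem theorem3p14:
  fixes p :: "nat \<Rightarrow> real"
  assumes "\<And>n. 1 \<le> p n"
    and "filterlim p at_top sequentially"
  shows "(\<forall>x. greedy_basic_sequence (nakano_norm p) (nakano_h p) x \<longrightarrow>
            equivalent_sequences (nakano_norm p) x c0_norm unit_vector) \<and>
         (\<forall>Y. closed_subspace (nakano_norm p) (nakano_h p) Y \<longrightarrow>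
            ((\<exists>x. greedy_basis (nakano_norm p) Y x) \<longleftrightarrow>
             isomorphic_spaces (nakano_norm p) Y c0_norm c0_space)) \<and>
         ((\<exists>x. greedy_basis (nakano_norm p) (nakano_h p) x) \<longleftrightarrow>
            nakano_h p = c0_space \<and>
            equivalent_norms_on c0_space (nakano_norm p) c0_norm)"
proof -
  interpret nakano_space_inf p
    by unfold_locales (rule assms)+
  show ?thesis
    by (intro conjI allI impI greedy_basic_sequence_equivalent_c0 subspace_greedy_basis_iff
        h_greedy_basis_iff)
qed

end
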